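(* Let $\Lambda$ be a finite $k$-graph, let $(X,\mathcal F,\mu)$ be a measure space, and let $e_1,\dots,e_k$ be the standard basis of $\mathbb N^k$. For each $1\le i\le k$, suppose we have a semibranching function system $\{\tau_\lambda: D_\lambda\to R_\lambda\}_{\lambda\in\Lambda,\ d(\lambda)=e_i}$ on $X$ with associated coding map $\tau^{e_i}:X\to X$. For $\eta\in\Lambda$ with $d(\eta)\neq 0$, write $\eta=\eta_1\eta_2\cdots\eta_\ell$ as a sequence of edges and define $$\tau_\eta:=\tau_{\eta_1}\circ\tau_{\eta_2}\circ\cdots\circ\tau_{\eta_\ell};$$ for $v\in\Lambda^0$ let $\tau_v:=\mathrm{id}_{D_v}$. Then the semibranching function systems $\{\tau_\lambda: d(\lambda)=e_i\}_{i=1}^k$ and coding maps $\{\tau^{e_i}\}_{i=1}^k$ satisfy conditions (i)-(v) below if and only if the maps $\{\tau_\eta:\eta\in\Lambda\}$ form a $\Lambda$-semibranching function system on $(X,\mu)$ with coding maps $\tau^m:=(\tau^{e_1})^{m_1}\circ(\tau^{e_2})^{m_2}\circ\cdots\circ(\tau^{e_k})^{m_k}$ for $m=(m_1,\dots,m_k)\in\mathbb N^k$. (i) For any edges $\lambda,\nu$ with $s(\lambda)=s(\nu)$ we have $D_\lambda=D_\nu$. Writing $v=s(\lambda)=s(\nu)$, we set $D_v:=D_\lambda=D_\nu$, and we require $\mu(D_v)>0$ for all $v\in\Lambda^0$. (ii) For $v\ne w\in\Lambda^0$, $\mu(D_v\cap D_w)=0$. (iii) Fix $i,j\in\{1,\dots,k\}$.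 If $\lambda\alpha=\nu\beta$ for $\lambda,\beta\in\Lambda^{e_i}$ and $\nu,\alpha\in\Lambda^{e_j}$, then $R_\alpha\subset D_\lambda$, $R_\beta\subset D_\nu$ and $\tau_\lambda\circ\tau_\alpha=\tau_\nu\circ\tau_\beta$. (iv) For any $1\le i,j\le k$, $\tau^{e_i}\circ\tau^{e_j}=\tau^{e_j}\circ\tau^{e_i}$. (v) For $v\in\Lambda^0$ and $1\le i\le k$, $\mu\big(D_v\setminus\bigcup_{g\in v\Lambda^{e_i}}R_g\big)=0$.
   Context: $\mathbb N=\{0,1,2,\dots\}$. A $k$-graph is a countable small category $\Lambda$ with a degree functor $d:\Lambda\to\mathbb N^k$ satisfying the factorization property: if $d(\lambda)=m+n$ then there are unique $\mu,\nu\in\Lambda$ with $\lambda=\mu\nu$, $d(\mu)=m$, $d(\nu)=n$. Morphisms are called paths; $\Lambda^n=d^{-1}(n)$; $\Lambda^0$ is the set of objects (vertices, identified with identity morphisms); elements of $\Lambda^{e_i}$ (any $i$) are called edges; $r,s$ are the range and source maps, $\lambda\nu$ being defined when $s(\lambda)=r(\nu)$; $v\Lambda^n=\{\lambda\in\Lambda^n: r(\lambda)=v\}$, and $s(\lambda)\Lambda=\{\nu\in\Lambda : r(\nu)=s(\lambda)\}$. $\Lambda$ is finite if $\Lambda^n$ is a finite set for every $n\in\mathbb N^k$. Semibranching function system: given a measure space $(X,\mu)$ and, for each $i$ in a finite index set, a measurable map $\sigma_i:D_i\to X$ with $D_i\subset X$ measurable, the family $\{\sigma_i\}$ is a semibranching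 function system if (a) setting $R_i=\sigma_i(D_i)$, $\mu(X\setminus\bigcup_iR_i)=0$ and $\mu(R_i\cap R_j)=0$ for $i\neq j$; (b) for each $i$ the Radon--Nikodym derivative $\Phi_{\sigma_i}=\frac{d(\mu\circ\sigma_i)}{d\mu}$ satisfies $\Phi_{\sigma_i}>0$ $\mu$-a.e. on $D_i$. (Here $\mu\circ\sigma_i$ is the measure $E\mapsto\mu(\sigma_i(E))$ on $D_i$.) A measurable map $\sigma:X\to X$ is a coding map for the family if $\sigma\circ\sigma_i(x)=x$ for all $x\in D_i$. $\Lambda$-semibranching function system (for a finite $k$-graph $\Lambda$) on $(X,\mu)$: a collection $\{D_\lambda\}_{\lambda\in\Lambda}$ of measurable subsets of $X$, prefixing maps $\{\tau_\lambda:D_\lambda\to X\}_{\lambda\in\Lambda}$ and coding maps $\{\tau^m:X\to X\}_{m\in\mathbb N^k}$ such that: (a) for each $m\in\mathbb N^k$, $\{\tau_\lambda:d(\lambda)=m\}$ is a semibranching function system with coding map $\tau^m$; (b) if $v\in\Lambda^0$ then $\tau_v=\mathrm{id}$ and $\mu(D_v)>0$; (c) with $R_\lambda=\tau_\lambda(D_\lambda)$, for each $\lambda\in\Lambda$ and $\nu\in s(\lambda)\Lambda$ we have $R_\nu\subseteq D_\lambda$ up to a set of measure $0$ and $\tau_\lambda\tau_\nu=\tau_{\lambda\nu}$ a.e. (so up to null sets $D_{\lambda\nu}=D_\nu$); (d) $\tau^m\circ\tau^n=\tau^{m+n}$ for all $m,n\in\mathbb N^k$. Equalities and inclusions between the sets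 $D_\lambda,R_\lambda$, and domains and equalities of compositions of the prefixing maps, are understood up to $\mu$-null sets. *)

theory Defs
  imports "HOL-Analysis.Analysis"
begin

section \<open>Higher-rank graphs\<close>

text \<open>
  A small category is given by its morphisms (paths); an object is identified with its
  identity morphism, so \<open>rng\<close> and \<open>src\<close> take values in the paths. The index type \<open>'k\<close>
  (finite, nonempty) plays the role of \<open>{1, \<dots>, k}\<close>, \<open>nat ^ 'k\<close> is \<open>\<nat>\<^sup>k\<close>, and \<open>axis i 1\<close> is
  the basis vector \<open>e\<^sub>i\<close>. The linear order on \<open>'k\<close> is used only to fix the order of the
  factors in the product defining the coding map of a general degree.
\<close>

record ('p, 'k) kgraph =
  paths :: "'p set"
  rng :: "'p \<Rightarrow> 'p"
  src :: "'p \<Rightarrow> 'p"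
  pcomp :: "'p \<Rightarrow> 'p \<Rightarrow> 'p"
  deg :: "'p \<Rightarrow> nat ^ 'k"

definition small_category :: "('p, 'k::finite) kgraph \<Rightarrow> bool" where
  "small_category \<Lambda> \<longleftrightarrow>
     (\<forall>l\<in>paths \<Lambda>. rng \<Lambda> l \<in> paths \<Lambda> \<and> src \<Lambda> l \<in> paths \<Lambda> \<and>
        rng \<Lambda> (rng \<Lambda> l) = rng \<Lambda> l \<and> src \<Lambda> (rng \<Lambda> l) = rng \<Lambda> l \<and>
        rng \<Lambda> (src \<Lambda> l) = src \<Lambda> l \<and> src \<Lambda> (src \<Lambda> l) = src \<Lambda> l \<and>
        pcomp \<Lambda> (rng \<Lambda> l) l = l \<and> pcomp \<Lambda> l (src \<Lambda> l) = l) \<and>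
     (\<forall>l\<in>paths \<Lambda>. \<forall>n\<in>paths \<Lambda>. src \<Lambda> l = rng \<Lambda> n \<longrightarrow>
        pcomp \<Lambda> l n \<in> paths \<Lambda> \<and>
        rng \<Lambda> (pcomp \<Lambda> l n) = rng \<Lambda> l \<and> src \<Lambda> (pcomp \<Lambda> l n) = src \<Lambda> n) \<and>
     (\<forall>l\<in>paths \<Lambda>. \<forall>n\<in>paths \<Lambda>. \<forall>q\<in>paths \<Lambda>.
        src \<Lambda> l = rng \<Lambda> n \<longrightarrow> src \<Lambda> n = rng \<Lambda> q \<longrightarrow>
        pcomp \<Lambda> (pcomp \<Lambda> l n) q = pcomp \<Lambda> l (pcomp \<Lambda> n q))"

definition k_graph :: "('p, 'k::finite) kgraph \<Rightarrow> bool" where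
  "k_graph \<Lambda> \<longleftrightarrow>
     small_category \<Lambda> \<and> countable (paths \<Lambda>) \<and>
     (\<forall>l\<in>paths \<Lambda>. deg \<Lambda> (rng \<Lambda> l) = 0 \<and> deg \<Lambda> (src \<Lambda> l) = 0) \<and>
     (\<forall>l\<in>paths \<Lambda>. \<forall>n\<in>paths \<Lambda>. src \<Lambda> l = rng \<Lambda> n \<longrightarrow>
        deg \<Lambda> (pcomp \<Lambda> l n) = deg \<Lambda> l + deg \<Lambda> n) \<and>
     (\<forall>l\<in>paths \<Lambda>. \<forall>m n. deg \<Lambda> l = m + n \<longrightarrow>
        (\<exists>!p. case p of (a, b) \<Rightarrow>
           a \<in> paths \<Lambda> \<and> b \<in> paths \<Lambda> \<and> src \<Lambda> a = rng \<Lambda> b \<and>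
           l = pcomp \<Lambda> a b \<and> deg \<Lambda> a = m \<and> deg \<Lambda> b = n))"

definition paths_of_degree :: "('p, 'k::finite) kgraph \<Rightarrow> nat ^ 'k \<Rightarrow> 'p set" where
  "paths_of_degree \<Lambda> n = {l \<in> paths \<Lambda>. deg \<Lambda> l = n}"

abbreviation vertices :: "('p, 'k::finite) kgraph \<Rightarrow> 'p set" where
  "vertices \<Lambda> \<equiv> paths_of_degree \<Lambda> 0"

definition edges :: "('p, 'k::finite) kgraph \<Rightarrow> 'p set" where
  "edges \<Lambda> = (\<Union>i. paths_of_degree \<Lambda> (axis i 1))"

definition finite_k_graph :: "('p, 'k::finite) kgraph \<Rightarrow> bool" where
  "finite_k_graph \<Lambda> \<longleftrightarrow> k_graph \<Lambda> \<and> (\<forall>n. finite (paths_of_degree \<Lambda> n))"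

text \<open>The paths of degree 0 are exactly the objects (identity morphisms).\<close>

lemma vertices_eq_identities:
  assumes "k_graph \<Lambda>"
  shows "vertices \<Lambda> = {v \<in> paths \<Lambda>. rng \<Lambda> v = v}"
proof (intro set_eqI iffI)
  fix v assume v: "v \<in> vertices \<Lambda>"
  let ?Q = "\<lambda>p. case p of (a, b) \<Rightarrow>
           a \<in> paths \<Lambda> \<and> b \<in> paths \<Lambda> \<and> src \<Lambda> a = rng \<Lambda> b \<and>
           v = pcomp \<Lambda> a b \<and> deg \<Lambda> a = 0 \<and> deg \<Lambda> b = 0"
  have "v \<in> paths \<Lambda>" "deg \<Lambda> v = 0 + 0"
    using v by (auto simp: paths_of_degree_def)
  then have "\<exists>!p. ?Q p"
    using assms unfolding k_graph_def by blast
  moreover have "?Q (rng \<Lambda> v, v)" "?Q (v, src \<Lambda> v)"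
    using assms \<open>v \<in> paths \<Lambda>\<close> \<open>deg \<Lambda> v = 0 + 0\<close>
    by (simp_all add: k_graph_def small_category_def)
  ultimately have "(rng \<Lambda> v, v) = (v, src \<Lambda> v)"
    by blast
  then show "v \<in> {v \<in> paths \<Lambda>. rng \<Lambda> v = v}"
    using \<open>v \<in> paths \<Lambda>\<close> by simp
next
  fix v assume "v \<in> {v \<in> paths \<Lambda>. rng \<Lambda> v = v}"
  then have "v \<in> paths \<Lambda>" "rng \<Lambda> v = v" by auto
  moreover have "deg \<Lambda> (rng \<Lambda> v) = 0"
    using assms \<open>v \<in> paths \<Lambda>\<close> by (simp add: k_graph_def)
  ultimately show "v \<in> vertices \<Lambda>"
    by (simp add: paths_of_degree_def)
qed

text \<open>\<open>edge_sequence \<Lambda> [h\<^sub>1, \<dots>, h\<^sub>l] h\<close> means that \<open>h = h\<^sub>1 \<cdots> h\<^sub>l\<close> with all \<open>h\<^sub>j\<close> edges.\<close>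

inductive edge_sequence :: "('p, 'k::finite) kgraph \<Rightarrow> 'p list \<Rightarrow> 'p \<Rightarrow> bool"
  for \<Lambda> where
  single: "e \<in> edges \<Lambda> \<Longrightarrow> edge_sequence \<Lambda> [e] e"
| cons: "e \<in> edges \<Lambda> \<Longrightarrow> edge_sequence \<Lambda> es h \<Longrightarrow> src \<Lambda> e = rng \<Lambda> h \<Longrightarrow>
           edge_sequence \<Lambda> (e # es) (pcomp \<Lambda> e h)"


section \<open>Semibranching function systems\<close>

text \<open>
  A map \<open>f : D \<rightarrow> X\<close> with \<open>D \<subseteq> X\<close> is a partial map \<open>f :: 'a \<rightharpoonup> 'a\<close>, with \<open>D = dom f\<close> and
  \<open>f(D) = ran f\<close>. Composites \<open>f \<circ>\<^sub>m g\<close> have their natural domain, and almost everywhere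
  equality of partial maps, \<open>AE x in M. f x = g x\<close>, includes equality of the domains up to
  a null set.
\<close>

abbreviation img :: "('a \<rightharpoonup> 'a) \<Rightarrow> 'a set \<Rightarrow> 'a set" where
  "img f E \<equiv> (\<lambda>x. the (f x)) ` E"

definition measurable_partial_map :: "'a measure \<Rightarrow> ('a \<rightharpoonup> 'a) \<Rightarrow> bool" where
  "measurable_partial_map M f \<longleftrightarrow>
     dom f \<in> sets M \<and> (\<lambda>x. the (f x)) \<in> restrict_space M (dom f) \<rightarrow>\<^sub>M M"

definition pullback_measure :: "'a measure \<Rightarrow> ('a \<rightharpoonup> 'a) \<Rightarrow> 'a measure" where
  "pullback_measure M f =
     measure_of (dom f) (sets (restrict_space M (dom f))) (\<lambda>E. emeasure M (img f E))"

text \<open>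
  The first two conjuncts say that \<open>E \<mapsto> \<mu>(f(E))\<close> is a measure on \<open>dom f\<close> (\<open>emeasure\<close> is 0 on
  nonmeasurable sets, and \<open>measure_of\<close> yields the zero measure for a set function that is not a
  measure); the third says that it has a density, since \<open>RN_deriv\<close> is 0 if there is none.
\<close>

definition positive_RN_deriv :: "'a measure \<Rightarrow> ('a \<rightharpoonup> 'a) \<Rightarrow> bool" where
  "positive_RN_deriv M f \<longleftrightarrow>
     (let D = restrict_space M (dom f); \<Phi> = RN_deriv D (pullback_measure M f) in
       (\<forall>E\<in>sets D. img f E \<in> sets M) \<and>
       measure_space (dom f) (sets D) (\<lambda>E. emeasure M (img f E)) \<and>
       density D \<Phi> = pullback_measure M f \<and>
       (AE x in D. \<Phi> x > 0))"

definition semibranching :: "'a measure \<Rightarrow> 'i set \<Rightarrow> ('i \<Rightarrow> 'a \<rightharpoonup> 'a) \<Rightarrow> bool" where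
  "semibranching M I \<sigma> \<longleftrightarrow>
     finite I \<and>
     (\<forall>i\<in>I. measurable_partial_map M (\<sigma> i)) \<and>
     space M - (\<Union>i\<in>I. ran (\<sigma> i)) \<in> null_sets M \<and>
     (\<forall>i\<in>I. \<forall>j\<in>I. i \<noteq> j \<longrightarrow> ran (\<sigma> i) \<inter> ran (\<sigma> j) \<in> null_sets M) \<and>
     (\<forall>i\<in>I. positive_RN_deriv M (\<sigma> i))"

definition coding_map ::
  "'a measure \<Rightarrow> 'i set \<Rightarrow> ('i \<Rightarrow> 'a \<rightharpoonup> 'a) \<Rightarrow> ('a \<Rightarrow> 'a) \<Rightarrow> bool" where
  "coding_map M I \<sigma> c \<longleftrightarrow>
     c \<in> M \<rightarrow>\<^sub>M M \<and> (\<forall>i\<in>I. \<forall>x\<in>dom (\<sigma> i). c (the (\<sigma> i x)) = x)"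

definition Lambda_semibranching ::
  "('p, 'k::finite) kgraph \<Rightarrow> 'a measure \<Rightarrow> ('p \<Rightarrow> 'a \<rightharpoonup> 'a) \<Rightarrow> (nat ^ 'k \<Rightarrow> 'a \<Rightarrow> 'a) \<Rightarrow> bool"
  where
  "Lambda_semibranching \<Lambda> M \<tau> c \<longleftrightarrow>
     (\<forall>m. semibranching M (paths_of_degree \<Lambda> m) \<tau> \<and>
          coding_map M (paths_of_degree \<Lambda> m) \<tau> (c m)) \<and>
     (\<forall>v\<in>vertices \<Lambda>. (\<forall>x\<in>dom (\<tau> v). \<tau> v x = Some x) \<and> emeasure M (dom (\<tau> v)) > 0) \<and>
     (\<forall>l\<in>paths \<Lambda>. \<forall>n\<in>paths \<Lambda>. src \<Lambda> l = rng \<Lambda> n \<longrightarrow>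
        (AE x in M. x \<in> ran (\<tau> n) \<longrightarrow> x \<in> dom (\<tau> l)) \<and>
        (AE x in M. (\<tau> l \<circ>\<^sub>m \<tau> n) x = \<tau> (pcomp \<Lambda> l n) x)) \<and>
     (\<forall>m n. \<forall>x\<in>space M. c m (c n x) = c (m + n) x)"


section \<open>Extending edge maps to all paths\<close>

text \<open>
  The common domain \<open>D\<^sub>v\<close> of the maps of the edges with source \<open>v\<close>. These domains are only required
  to agree up to null sets; the (finite) union is one choice of \<open>D\<^sub>v\<close>, equal to each of them
  whenever they agree. It is empty, hence null, if no edge has source \<open>v\<close>.
\<close>

definition vertex_domain :: "('p, 'k::finite) kgraph \<Rightarrow> ('p \<Rightarrow> 'a \<rightharpoonup> 'a) \<Rightarrow> 'p \<Rightarrow> 'a set" where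
  "vertex_domain \<Lambda> \<tau> v = (\<Union>l\<in>{l \<in> edges \<Lambda>. src \<Lambda> l = v}. dom (\<tau> l))"

text \<open>
  Here \<open>\<phi> h\<close> is the chosen sequence of edges with composite \<open>h\<close>; only the values of \<open>\<tau>\<close> on
  edges are used.
\<close>

definition path_maps ::
  "('p, 'k::finite) kgraph \<Rightarrow> ('p \<Rightarrow> 'p list) \<Rightarrow> ('p \<Rightarrow> 'a \<rightharpoonup> 'a) \<Rightarrow> 'p \<Rightarrow> 'a \<rightharpoonup> 'a" where
  "path_maps \<Lambda> \<phi> \<tau> h =
     (if deg \<Lambda> h = 0 then Some |` vertex_domain \<Lambda> \<tau> h
      else foldr (\<circ>\<^sub>m) (map \<tau> (\<phi> h)) Some)"

definition coding_power ::
  "('k \<Rightarrow> 'a \<Rightarrow> 'a) \<Rightarrow> nat ^ 'k::{finite,linorder} \<Rightarrow> 'a \<Rightarrow> 'a" where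
  "coding_power c m = foldr (\<circ>) (map (\<lambda>i. c i ^^ (m $ i)) (sorted_list_of_set UNIV)) id"

end

theory Submission
  imports Defs
begin

text \<open>
  An edge map is injective, because the coding map inverts it, and its Radon--Nikodym derivative
  is positive, so it pulls null sets back to null sets and sends null sets to null sets. Composites
  inherit both properties (\<open>nonsingular_embedding_comp\<close>). Almost everywhere statements can
  therefore be carried along all maps in sight, in both directions (\<open>AE_pullback\<close>,
  \<open>AE_pushforward\<close>), and identities between paths turn into identities of maps up to null sets.

  Suppose (i)--(v). Two ways of writing a path as a sequence of edges differ by exchanges
  \<open>\<lambda>\<alpha> = \<nu>\<beta>\<close> of neighbouring edges of different degrees, and (iii) says that such an exchange
  does not change the composite map; so \<open>\<tau>\<^sub>\<eta>\<close> does not depend on the chosen sequence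
  (\<open>word_unique\<close>) and \<open>\<tau>\<^sub>\<lambda>\<tau>\<^sub>\<nu> = \<tau>\<^sub>\<lambda>\<^sub>\<nu>\<close> (\<open>path_comp\<close>). By (i) and (iii) the map \<open>\<tau>\<^sub>\<eta>\<close> has domain
  \<open>D\<close> of the source of \<open>\<eta>\<close> and range inside \<open>D\<close> of its range vertex. The degrees \<open>m\<close> for which the
  ranges \<open>R\<^sub>\<eta>\<close> with \<open>d(\<eta>) = m\<close> partition the space contain \<open>0\<close> and all \<open>e\<^sub>i\<close> and are closed under
  addition: by (ii), \<open>D\<^sub>v\<close> is partitioned by the \<open>R\<^sub>\<alpha>\<close> of degree \<open>n\<close> with range \<open>v\<close>, and \<open>\<tau>\<^sub>\<lambda>\<close> transports
  this partition into \<open>R\<^sub>\<lambda>\<close> (\<open>path_cover\<close>, \<open>path_disjoint\<close>). The coding identities hold exactly,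
  since by (iv) the factors of a coding map may be rearranged to follow a given edge sequence.

  Conversely, a \<open>\<Lambda>\<close>-semibranching system restricts to the given maps on edges, and (i)--(v) are read
  off from its axioms in degrees \<open>0\<close>, \<open>e\<^sub>i\<close> and \<open>e\<^sub>i + e\<^sub>j\<close>. Applying the composition
  axiom to an edge \<open>\<lambda>\<close> and one of its end vertices shows that \<open>D\<^sub>\<lambda>\<close> contains \<open>D\<close> of the source of \<open>\<lambda>\<close>,
  and that \<open>R\<^sub>\<lambda>\<close> is contained in \<open>D\<close> of its range vertex.
\<close>


section \<open>Degrees and factorizations\<close>

lemma total_degree_axis: "(\<Sum>j\<in>UNIV. (axis i (Suc 0) :: nat ^ 'k::finite) $ j) = Suc 0"
  by (simp add: axis_def)

lemma degree_split:
  fixes m :: "nat ^ 'k::finite"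
  assumes "m $ i \<noteq> 0"
  obtains n where "m = axis i 1 + n"
proof
  show "m = axis i 1 + (m - axis i 1)"
    using assms by (auto simp: vec_eq_iff axis_def)
qed

text \<open>
  Properties of degrees that pass to sums need to be checked only on \<open>0\<close> and on the basis vectors.
\<close>

lemma degree_induct [case_names zero axis add]:
  fixes m :: "nat ^ 'k::finite"
  assumes zero: "P 0" and axis: "\<And>i. P (axis i 1)"
    and add: "\<And>m n. P m \<Longrightarrow> P n \<Longrightarrow> P (m + n)"
  shows "P m"
proof (induction "\<Sum>j\<in>UNIV. m $ j" arbitrary: m rule: less_induct)
  case less
  show ?case
  proof (cases "m = 0")
    case False
    then obtain i where "m $ i \<noteq> 0"
      by (auto simp: vec_eq_iff)
    then obtain n where n: "m = axis i 1 + n"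
      by (rule degree_split)
    then have "(\<Sum>j\<in>UNIV. m $ j) = 1 + (\<Sum>j\<in>UNIV. n $ j)"
      by (simp add: sum.distrib total_degree_axis)
    then have "P n"
      using less by simp
    then show ?thesis
      using n axis add by blast
  qed (simp add: zero)
qed

lemma ex1_implies_eq: "P x \<Longrightarrow> P y \<Longrightarrow> \<exists>!z. P z \<Longrightarrow> x = y"
  by blast

locale higher_rank_graph =
  fixes \<Lambda> :: "('p, 'k::finite) kgraph"
  assumes k_graph: "k_graph \<Lambda>"
begin

lemma rng_path [simp]: "h \<in> paths \<Lambda> \<Longrightarrow> rng \<Lambda> h \<in> paths \<Lambda>"
  and src_path [simp]: "h \<in> paths \<Lambda> \<Longrightarrow> src \<Lambda> h \<in> paths \<Lambda>"
  and deg_rng [simp]: "h \<in> paths \<Lambda> \<Longrightarrow> deg \<Lambda> (rng \<Lambda> h) = 0"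
  and deg_src [simp]: "h \<in> paths \<Lambda> \<Longrightarrow> deg \<Lambda> (src \<Lambda> h) = 0"
  and src_rng [simp]: "h \<in> paths \<Lambda> \<Longrightarrow> src \<Lambda> (rng \<Lambda> h) = rng \<Lambda> h"
  and rng_src [simp]: "h \<in> paths \<Lambda> \<Longrightarrow> rng \<Lambda> (src \<Lambda> h) = src \<Lambda> h"
  and pcomp_rng [simp]: "h \<in> paths \<Lambda> \<Longrightarrow> pcomp \<Lambda> (rng \<Lambda> h) h = h"
  and pcomp_src [simp]: "h \<in> paths \<Lambda> \<Longrightarrow> pcomp \<Lambda> h (src \<Lambda> h) = h"
  using k_graph by (simp_all add: k_graph_def small_category_def)

lemma pcomp [simp]:
  assumes "l \<in> paths \<Lambda>" "n \<in> paths \<Lambda>" "src \<Lambda> l = rng \<Lambda> n"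
  shows pcomp_path: "pcomp \<Lambda> l n \<in> paths \<Lambda>"
    and rng_pcomp: "rng \<Lambda> (pcomp \<Lambda> l n) = rng \<Lambda> l"
    and src_pcomp: "src \<Lambda> (pcomp \<Lambda> l n) = src \<Lambda> n"
    and deg_pcomp: "deg \<Lambda> (pcomp \<Lambda> l n) = deg \<Lambda> l + deg \<Lambda> n"
  using k_graph assms by (simp_all add: k_graph_def small_category_def)

lemma pcomp_assoc:
  assumes "l \<in> paths \<Lambda>" "n \<in> paths \<Lambda>" "q \<in> paths \<Lambda>" "src \<Lambda> l = rng \<Lambda> n" "src \<Lambda> n = rng \<Lambda> q"
  shows "pcomp \<Lambda> (pcomp \<Lambda> l n) q = pcomp \<Lambda> l (pcomp \<Lambda> n q)"
  using k_graph assms by (simp add: k_graph_def small_category_def)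

lemma vertexD:
  assumes "h \<in> paths \<Lambda>" "deg \<Lambda> h = 0"
  shows rng_vertex: "rng \<Lambda> h = h" and src_vertex: "src \<Lambda> h = h"
proof -
  have "h \<in> vertices \<Lambda>"
    using assms by (simp add: paths_of_degree_def)
  then show "rng \<Lambda> h = h"
    using vertices_eq_identities[OF k_graph] by blast
  then show "src \<Lambda> h = h"
    using src_rng[OF assms(1)] by simp
qed

lemma factorization_ex1:
  assumes "h \<in> paths \<Lambda>" "deg \<Lambda> h = m + n"
  shows "\<exists>!p. case p of (a, b) \<Rightarrow> a \<in> paths \<Lambda> \<and> b \<in> paths \<Lambda> \<and> src \<Lambda> a = rng \<Lambda> b \<and>
           h = pcomp \<Lambda> a b \<and> deg \<Lambda> a = m \<and> deg \<Lambda> b = n"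
proof -
  have "\<forall>l\<in>paths \<Lambda>. \<forall>m n. deg \<Lambda> l = m + n \<longrightarrow>
        (\<exists>!p. case p of (a, b) \<Rightarrow>
           a \<in> paths \<Lambda> \<and> b \<in> paths \<Lambda> \<and> src \<Lambda> a = rng \<Lambda> b \<and>
           l = pcomp \<Lambda> a b \<and> deg \<Lambda> a = m \<and> deg \<Lambda> b = n)"
    using k_graph unfolding k_graph_def by (elim conjE)
  from this[rule_format, OF assms] show ?thesis .
qed

lemma factorization:
  assumes "h \<in> paths \<Lambda>" "deg \<Lambda> h = m + n"
  obtains a b where "a \<in> paths \<Lambda>" "b \<in> paths \<Lambda>" "src \<Lambda> a = rng \<Lambda> b" "h = pcomp \<Lambda> a b"
    "deg \<Lambda> a = m" "deg \<Lambda> b = n"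
proof -
  obtain p where "case p of (a, b) \<Rightarrow> a \<in> paths \<Lambda> \<and> b \<in> paths \<Lambda> \<and> src \<Lambda> a = rng \<Lambda> b \<and>
           h = pcomp \<Lambda> a b \<and> deg \<Lambda> a = m \<and> deg \<Lambda> b = n"
    using ex1_implies_ex[OF factorization_ex1[OF assms]] by (rule exE)
  then show thesis
    using that by (cases p) auto
qed

text \<open>
  Prescribing the degree of the first factor suffices, since it determines that of the second.
\<close>

lemma factorization_unique:
  assumes "a \<in> paths \<Lambda>" "b \<in> paths \<Lambda>" "src \<Lambda> a = rng \<Lambda> b"
    and "a' \<in> paths \<Lambda>" "b' \<in> paths \<Lambda>" "src \<Lambda> a' = rng \<Lambda> b'"
    and eq: "pcomp \<Lambda> a b = pcomp \<Lambda> a' b'" and "deg \<Lambda> a = deg \<Lambda> a'"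
  shows "a = a' \<and> b = b'"
proof -
  let ?h = "pcomp \<Lambda> a b"
  let ?Q = "\<lambda>p. case p of (x, y) \<Rightarrow> x \<in> paths \<Lambda> \<and> y \<in> paths \<Lambda> \<and> src \<Lambda> x = rng \<Lambda> y \<and>
           ?h = pcomp \<Lambda> x y \<and> deg \<Lambda> x = deg \<Lambda> a \<and> deg \<Lambda> y = deg \<Lambda> b"
  have "deg \<Lambda> a + deg \<Lambda> b' = deg \<Lambda> a + deg \<Lambda> b"
    using deg_pcomp[OF assms(1-3)] deg_pcomp[OF assms(4-6)] eq assms(8) by argo
  then have "deg \<Lambda> b' = deg \<Lambda> b"
    by (rule add_left_imp_eq)
  then have "?Q (a, b)" "?Q (a', b')"
    using assms by auto
  moreover have "\<exists>!p. ?Q p"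
    by (rule factorization_ex1) (use assms(1-3) in simp_all)
  ultimately have "(a, b) = (a', b')"
    by (rule ex1_implies_eq)
  then show ?thesis by simp
qed

lemma edges_iff: "e \<in> edges \<Lambda> \<longleftrightarrow> e \<in> paths \<Lambda> \<and> (\<exists>i. deg \<Lambda> e = axis i 1)"
  by (auto simp: edges_def paths_of_degree_def)

lemma edge_path [simp]: "e \<in> edges \<Lambda> \<Longrightarrow> e \<in> paths \<Lambda>"
  by (simp add: edges_iff)

lemma edge_sequence_path: "edge_sequence \<Lambda> es h \<Longrightarrow> h \<in> paths \<Lambda>"
  by (induction rule: edge_sequence.induct) auto

lemma edge_sequence_edges: "edge_sequence \<Lambda> es h \<Longrightarrow> set es \<subseteq> edges \<Lambda>"
  by (induction rule: edge_sequence.induct) auto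

lemma edge_sequence_nonempty: "edge_sequence \<Lambda> es h \<Longrightarrow> es \<noteq> []"
  by (induction rule: edge_sequence.induct) auto

lemma edge_sequence_length:
  "edge_sequence \<Lambda> es h \<Longrightarrow> length es = (\<Sum>j\<in>UNIV. deg \<Lambda> h $ j)"
proof (induction rule: edge_sequence.induct)
  case (single e)
  then show ?case
    by (auto simp: edges_iff total_degree_axis)
next
  case (cons e es h)
  then have "h \<in> paths \<Lambda>"
    by (blast intro: edge_sequence_path)
  with cons show ?case
    by (auto simp: edges_iff total_degree_axis sum.distrib)
qed

text \<open>
  An edge has total degree 1, so it cannot be split further.
\<close>

lemma edge_sequence_edge:
  assumes "edge_sequence \<Lambda> es e" "e \<in> edges \<Lambda>"
  shows "es = [e]"
proof -
  have "length es = 1"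
    using edge_sequence_length[OF assms(1)] assms(2) by (auto simp: edges_iff total_degree_axis)
  with assms(1) show ?thesis
    by (cases rule: edge_sequence.cases) (auto dest: edge_sequence_nonempty)
qed

lemma edge_sequence_append:
  assumes "edge_sequence \<Lambda> es h" "edge_sequence \<Lambda> fs g" "src \<Lambda> h = rng \<Lambda> g"
  shows "edge_sequence \<Lambda> (es @ fs) (pcomp \<Lambda> h g)"
  using assms
proof (induction rule: edge_sequence.induct)
  case (single e)
  then show ?case by (simp add: edge_sequence.cons)
next
  case (cons e es h)
  have "h \<in> paths \<Lambda>" "g \<in> paths \<Lambda>"
    using cons by (auto intro: edge_sequence_path)
  have "src \<Lambda> h = rng \<Lambda> g" "src \<Lambda> e = rng \<Lambda> (pcomp \<Lambda> h g)"
    using cons \<open>h \<in> paths \<Lambda>\<close> \<open>g \<in> paths \<Lambda>\<close> by auto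
  then have "edge_sequence \<Lambda> (e # es @ fs) (pcomp \<Lambda> e (pcomp \<Lambda> h g))"
    using cons by (blast intro: edge_sequence.cons)
  moreover have "pcomp \<Lambda> (pcomp \<Lambda> e h) g = pcomp \<Lambda> e (pcomp \<Lambda> h g)"
    by (rule pcomp_assoc) (use cons \<open>h \<in> paths \<Lambda>\<close> \<open>g \<in> paths \<Lambda>\<close> in auto)
  ultimately show ?case by simp
qed

end


section \<open>Nonsingular embeddings of a measure space\<close>

lemma ran_eq_img_dom: "ran f = img f (dom f)"
  by (force simp: ran_def)

lemma measurable_partial_map_iff:
  "measurable_partial_map M f \<longleftrightarrow>
     dom f \<in> sets M \<and> ran f \<subseteq> space M \<and> (\<forall>A\<in>sets M. {x \<in> dom f. the (f x) \<in> A} \<in> sets M)"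
proof (cases "dom f \<in> sets M")
  case True
  then have D: "dom f \<subseteq> space M" "dom f \<inter> space M \<in> sets M" "dom f \<inter> space M = dom f"
    using sets.sets_into_space by (auto simp: Int_absorb2)
  have vim: "(\<lambda>x. the (f x)) -` A \<inter> space (restrict_space M (dom f)) = {x \<in> dom f. the (f x) \<in> A}"
    for A using D by (auto simp: space_restrict_space)
  have "(\<lambda>x. the (f x)) \<in> restrict_space M (dom f) \<rightarrow>\<^sub>M M \<longleftrightarrow>
     ran f \<subseteq> space M \<and> (\<forall>A\<in>sets M. {x \<in> dom f. the (f x) \<in> A} \<in> sets M)"
    unfolding measurable_def mem_Collect_eq vim
    using D by (auto simp: sets_restrict_space_iff space_restrict_space ran_eq_img_dom)
  with True show ?thesis
    by (simp add: measurable_partial_map_def)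
qed (simp add: measurable_partial_map_def)

lemma sets_restrict_dom:
  assumes "dom f \<in> sets M"
  shows "sets (restrict_space M (dom f)) = {E \<in> sets M. E \<subseteq> dom f}"
    and "space (restrict_space M (dom f)) = dom f"
proof -
  have "dom f \<subseteq> space M" "dom f \<inter> space M \<in> sets M"
    using assms sets.sets_into_space by (auto simp: Int_absorb2)
  then show "sets (restrict_space M (dom f)) = {E \<in> sets M. E \<subseteq> dom f}"
    "space (restrict_space M (dom f)) = dom f"
    by (auto simp: sets_restrict_space_iff space_restrict_space)
qed

text \<open>
  A density makes the set function \<open>E \<mapsto> \<mu>(f(E))\<close> countably additive, so the measure that \<open>measure_of\<close>
  builds from it is not the default zero measure.
\<close>

lemma pullback_measure_eq_density:
  fixes M :: "'a measure"
  defines "D f \<equiv> restrict_space M (dom f)"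
  assumes f: "dom f \<in> sets M"
    and eq: "\<And>E. E \<in> sets (D f) \<Longrightarrow> emeasure M (img f E) = emeasure (density (D f) \<Phi>) E"
  shows "measure_space (dom f) (sets (D f)) (\<lambda>E. emeasure M (img f E))"
    and "pullback_measure M f = density (D f) \<Phi>"
proof -
  let ?N = "density (D f) \<Phi>"
  have sp: "space (D f) = dom f"
    unfolding D_def by (rule sets_restrict_dom[OF f])
  have sg: "sigma_sets (dom f) (sets (D f)) = sets (D f)"
    using sets.sigma_sets_eq[of "D f"] by (simp add: sp)
  have pow: "sets (D f) \<subseteq> Pow (dom f)"
    using sets.space_closed[of "D f"] by (simp add: sp)
  have "measure_space (dom f) (sets (D f)) (emeasure ?N)"
    using measure_space[of ?N] by (simp add: sp)
  then show "measure_space (dom f) (sets (D f)) (\<lambda>E. emeasure M (img f E))"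
    using measure_space_eq[OF pow, of "\<lambda>E. emeasure M (img f E)" "emeasure ?N"] eq sg by simp
  have "pullback_measure M f = measure_of (dom f) (sets (D f)) (emeasure ?N)"
    unfolding pullback_measure_def D_def[symmetric]
    by (rule measure_of_eq[OF pow]) (use eq sg in auto)
  also have "\<dots> = ?N"
    using measure_of_of_measure[of ?N] by (simp add: sp)
  finally show "pullback_measure M f = ?N" .
qed

lemma emeasure_density_restrict:
  assumes "dom f \<in> sets M" "E \<in> sets M" "E \<subseteq> dom f"
    and "\<Phi> \<in> borel_measurable (restrict_space M (dom f))"
  shows "emeasure (density (restrict_space M (dom f)) \<Phi>) E = (\<integral>\<^sup>+x\<in>E. \<Phi> x \<partial>M)"
proof -
  have D: "dom f \<inter> space M \<in> sets M"
    using assms(1) by auto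
  have "emeasure (density (restrict_space M (dom f)) \<Phi>) E
      = (\<integral>\<^sup>+x\<in>E. \<Phi> x \<partial>restrict_space M (dom f))"
    using assms by (intro emeasure_density) (auto simp: sets_restrict_dom)
  also have "\<dots> = (\<integral>\<^sup>+x. \<Phi> x * indicator E x * indicator (dom f) x \<partial>M)"
    by (rule nn_integral_restrict_space[OF D])
  also have "\<dots> = (\<integral>\<^sup>+x\<in>E. \<Phi> x \<partial>M)"
    using assms(3) by (intro nn_integral_cong) (auto split: split_indicator)
  finally show ?thesis .
qed

text \<open>
  A version of the Radon--Nikodym derivative of \<open>\<mu> \<circ> f\<close> that lives on the whole space rather than on
  the subspace \<open>dom f\<close>, so that derivatives of different maps can be multiplied.
\<close>

definition positive_jacobian :: "'a measure \<Rightarrow> ('a \<rightharpoonup> 'a) \<Rightarrow> ('a \<Rightarrow> ennreal) \<Rightarrow> bool" where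
  "positive_jacobian M f \<Phi> \<longleftrightarrow>
     \<Phi> \<in> borel_measurable M \<and> (AE x in M. x \<in> dom f \<longrightarrow> \<Phi> x > 0) \<and>
     (\<forall>E\<in>sets M. E \<subseteq> dom f \<longrightarrow>
        img f E \<in> sets M \<and> emeasure M (img f E) = (\<integral>\<^sup>+x\<in>E. \<Phi> x \<partial>M))"

lemma positive_jacobianD:
  assumes "positive_jacobian M f \<Phi>"
  shows "\<Phi> \<in> borel_measurable M" "AE x in M. x \<in> dom f \<longrightarrow> \<Phi> x > 0"
    "\<And>E. E \<in> sets M \<Longrightarrow> E \<subseteq> dom f \<Longrightarrow> img f E \<in> sets M"
    "\<And>E. E \<in> sets M \<Longrightarrow> E \<subseteq> dom f \<Longrightarrow> emeasure M (img f E) = (\<integral>\<^sup>+x\<in>E. \<Phi> x \<partial>M)"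
  using assms by (simp_all add: positive_jacobian_def)

text \<open>
  \<open>RN_deriv\<close> is an unspecified choice among all densities, and two densities of one measure may
  differ on a set of positive measure if the space is not sigma-finite. Positivity is nevertheless
  shared by all of them, because it says that this measure has no further null sets. So any convenient density, such as the
  one given by the chain rule for a composite, certifies positivity of the chosen one.
\<close>

lemma positive_RN_deriv_iff:
  assumes f: "measurable_partial_map M f"
  shows "positive_RN_deriv M f \<longleftrightarrow> (\<exists>\<Phi>. positive_jacobian M f \<Phi>)"
    (is "?L \<longleftrightarrow> ?R")
proof -
  define D where "D = restrict_space M (dom f)"
  have dom: "dom f \<in> sets M"
    using f by (simp add: measurable_partial_map_def)
  then have dom': "dom f \<inter> space M \<in> sets M"
    by auto
  note D = sets_restrict_dom[OF dom, folded D_def]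
  show ?thesis
  proof
    assume L: ?L
    define \<Phi> where "\<Phi> = RN_deriv D (pullback_measure M f)"
    have L': "\<forall>E\<in>sets D. img f E \<in> sets M"
      "measure_space (dom f) (sets D) (\<lambda>E. emeasure M (img f E))"
      "density D \<Phi> = pullback_measure M f" "AE x in D. \<Phi> x > 0"
      using L unfolding positive_RN_deriv_def Let_def D_def \<Phi>_def by blast+
    have [measurable]: "\<Phi> \<in> borel_measurable D"
      unfolding \<Phi>_def by simp
    have "emeasure M (img f E) = (\<integral>\<^sup>+x\<in>E. \<Phi> x \<partial>M)" if E: "E \<in> sets M" "E \<subseteq> dom f" for E
    proof -
      have sg: "sigma_sets (dom f) (sets D) = sets D"
        using sets.sigma_sets_eq[of D] by (simp add: D)
      have "emeasure M (img f E) = emeasure (pullback_measure M f) E"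
        unfolding pullback_measure_def D_def[symmetric] emeasure_measure_of_conv sg
        using E L'(2) D(1) by simp
      also have "\<dots> = (\<integral>\<^sup>+x\<in>E. \<Phi> x \<partial>M)"
        unfolding L'(3)[symmetric] D_def
        by (rule emeasure_density_restrict) (use dom E in \<open>auto simp flip: D_def\<close>)
      finally show ?thesis .
    qed
    then have "emeasure M (img f E) = (\<integral>\<^sup>+x\<in>E. \<Phi> x * indicator (dom f) x \<partial>M)"
      if "E \<in> sets M" "E \<subseteq> dom f" for E
      using that by (simp, intro nn_integral_cong) (auto split: split_indicator)
    moreover have "(\<lambda>x. \<Phi> x * indicator (dom f) x) \<in> borel_measurable M"
      using borel_measurable_restrict_space_iff_ennreal[OF dom', of \<Phi>] by (simp flip: D_def)
    moreover have "AE x in M. x \<in> dom f \<longrightarrow> \<Phi> x * indicator (dom f) x > 0"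
      using L'(4) unfolding D_def AE_restrict_space_iff[OF dom'] by (rule AE_mp) auto
    ultimately show ?R
      using L'(1) unfolding positive_jacobian_def
      by (intro exI[of _ "\<lambda>x. \<Phi> x * indicator (dom f) x"]) (simp add: D)
  next
    assume ?R
    then obtain \<Phi> where "positive_jacobian M f \<Phi>"
      by blast
    note \<Phi> = positive_jacobianD[OF this]
    have \<Phi>D: "\<Phi> \<in> borel_measurable D"
      unfolding D_def using \<Phi>(1) by (rule measurable_restrict_space1)
    have pos: "AE x in D. \<Phi> x > 0"
      using \<Phi>(2) unfolding D_def AE_restrict_space_iff[OF dom'] .
    have "emeasure M (img f E) = emeasure (density D \<Phi>) E" if "E \<in> sets D" for E
      using that \<Phi>(4) \<Phi>D dom unfolding D_def by (simp add: emeasure_density_restrict sets_restrict_dom)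
    note pb = pullback_measure_eq_density[OF dom this[unfolded D_def], folded D_def]
    define \<Psi> where "\<Psi> = RN_deriv D (pullback_measure M f)"
    have \<Psi>: "density D \<Psi> = density D \<Phi>" "\<Psi> \<in> borel_measurable D"
      unfolding \<Psi>_def using RN_derivI[OF \<Phi>D pb(2)[symmetric]] pb(2) by simp_all
    \<comment> \<open>The zero set of the chosen density \<open>\<Psi>\<close> is null: there \<open>\<Phi>\<close>, which is positive, has
        integral 0.\<close>
    define Z where "Z = {x \<in> space D. \<Psi> x = 0}"
    have Z: "Z \<in> sets D"
      unfolding Z_def using \<Psi>(2) by measurable
    have "emeasure (density D \<Phi>) Z = (\<integral>\<^sup>+x\<in>Z. \<Psi> x \<partial>D)"
      unfolding \<Psi>(1)[symmetric] using \<Psi>(2) Z by (rule emeasure_density)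
    also have "\<dots> = (\<integral>\<^sup>+x. 0 \<partial>D)"
      by (intro nn_integral_cong) (simp add: Z_def split: split_indicator)
    also have "\<dots> = 0"
      by simp
    finally have "Z \<in> null_sets (density D \<Phi>)"
      using Z by auto
    then have "AE x in D. x \<in> Z \<longrightarrow> \<Phi> x = 0"
      by (simp add: null_sets_density_iff[OF \<Phi>D])
    with pos have "AE x in D. \<Psi> x > 0"
    proof (rule AE_mp[OF _ AE_mp[OF _ AE_I2]], intro impI)
      fix x assume "x \<in> space D" "x \<in> Z \<longrightarrow> \<Phi> x = 0" "\<Phi> x > 0"
      then show "\<Psi> x > 0"
        by (cases "\<Psi> x = 0") (auto simp: Z_def zero_less_iff_neq_zero)
    qed
    then show ?L
      using pb \<Phi>(3) \<Psi>(1) unfolding positive_RN_deriv_def Let_def D_def[symmetric] \<Psi>_def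
      by (simp add: D)
  qed
qed

text \<open>
  The properties of edge maps that survive composition. Injectivity is what remains of the coding
  map; it makes the chain rule for \<open>E \<mapsto> \<mu>(f(g(E)))\<close> work.
\<close>

definition nonsingular_embedding :: "'a measure \<Rightarrow> ('a \<rightharpoonup> 'a) \<Rightarrow> bool" where
  "nonsingular_embedding M f \<longleftrightarrow>
     measurable_partial_map M f \<and> positive_RN_deriv M f \<and>
     (\<forall>x y z. f x = Some z \<longrightarrow> f y = Some z \<longrightarrow> x = y)"

lemma nonsingular_embedding_inj:
  "nonsingular_embedding M f \<Longrightarrow> f x = Some z \<Longrightarrow> f y = Some z \<Longrightarrow> x = y"
  unfolding nonsingular_embedding_def by blast

lemma nonsingular_embedding_dom: "nonsingular_embedding M f \<Longrightarrow> dom f \<in> sets M"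
  by (simp add: nonsingular_embedding_def measurable_partial_map_def)

lemma nonsingular_embedding_vimage:
  "nonsingular_embedding M f \<Longrightarrow> A \<in> sets M \<Longrightarrow> {x \<in> dom f. the (f x) \<in> A} \<in> sets M"
  by (simp add: nonsingular_embedding_def measurable_partial_map_iff)

lemma nonsingular_embedding_in_space:
  assumes "nonsingular_embedding M f" "f x = Some y"
  shows "x \<in> space M" "y \<in> space M"
proof -
  have "dom f \<in> sets M" "ran f \<subseteq> space M"
    using assms(1) by (simp_all add: nonsingular_embedding_def measurable_partial_map_iff)
  then show "x \<in> space M" "y \<in> space M"
    using assms(2) sets.sets_into_space[of "dom f" M] by (auto intro: ranI)
qed

lemma nonsingular_embeddingE:
  assumes "nonsingular_embedding M f"
  obtains \<Phi> where "positive_jacobian M f \<Phi>"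
proof -
  have "measurable_partial_map M f" "positive_RN_deriv M f"
    using assms by (simp_all add: nonsingular_embedding_def)
  then have "\<exists>\<Phi>. positive_jacobian M f \<Phi>"
    by (simp add: positive_RN_deriv_iff)
  then show thesis
    by (elim exE that)
qed

lemma nonsingular_embeddingI:
  assumes "measurable_partial_map M f" "positive_jacobian M f \<Phi>"
    and "\<And>x y z. f x = Some z \<Longrightarrow> f y = Some z \<Longrightarrow> x = y"
  shows "nonsingular_embedding M f"
proof -
  have "positive_RN_deriv M f"
    unfolding positive_RN_deriv_iff[OF assms(1)] by (intro exI) (rule assms(2))
  with assms(1) show ?thesis
    unfolding nonsingular_embedding_def by (auto intro: assms(3))
qed

lemma nonsingular_embedding_ran:
  assumes f: "nonsingular_embedding M f"
  shows "ran f \<in> sets M"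
proof -
  obtain \<Phi> where "positive_jacobian M f \<Phi>"
    using f by (rule nonsingular_embeddingE)
  from positive_jacobianD(3)[OF this] show ?thesis
    using nonsingular_embedding_dom[OF f] by (simp add: ran_eq_img_dom)
qed

text \<open>
  If \<open>f(S)\<close> lies in a null set, then the positive derivative has integral 0 over \<open>S\<close>, so \<open>S\<close> is null.
\<close>

lemma AE_pullback:
  assumes f: "nonsingular_embedding M f" and P: "AE y in M. P y"
  shows "AE x in M. \<forall>y. f x = Some y \<longrightarrow> P y"
proof -
  obtain \<Phi> where "positive_jacobian M f \<Phi>"
    using f by (rule nonsingular_embeddingE)
  note \<Phi> = positive_jacobianD[OF this]
  obtain N where N: "{y \<in> space M. \<not> P y} \<subseteq> N" "N \<in> null_sets M"
    using P by (auto simp: eventually_ae_filter)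
  define S where "S = {x \<in> dom f. the (f x) \<in> N}"
  have S: "S \<in> sets M" "S \<subseteq> dom f"
    unfolding S_def using nonsingular_embedding_vimage[OF f] N(2) by auto
  have "img f S \<in> null_sets M"
    by (rule null_sets_subset[OF N(2) \<Phi>(3)[OF S]]) (auto simp: S_def)
  then have "(\<integral>\<^sup>+x\<in>S. \<Phi> x \<partial>M) = 0"
    using \<Phi>(4)[OF S] by auto
  then have "AE x in M. \<Phi> x * indicator S x = 0"
    using \<Phi>(1) S(1) by (subst (asm) nn_integral_0_iff_AE) auto
  then show ?thesis
    using \<Phi>(2)
  proof eventually_elim
    case (elim x)
    then have "x \<notin> S"
      using S(2) by (auto simp: indicator_def)
    then show ?case
      using N(1) nonsingular_embedding_in_space[OF f] by (force simp: S_def)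
  qed
qed

text \<open>
  The image of a null set is null because \<open>\<mu> \<circ> f\<close> has a density.
\<close>

lemma AE_pushforward:
  assumes f: "nonsingular_embedding M f" and P: "AE x in M. P x"
  shows "AE y in M. \<forall>x. f x = Some y \<longrightarrow> P x"
proof -
  obtain \<Phi> where "positive_jacobian M f \<Phi>"
    using f by (rule nonsingular_embeddingE)
  note \<Phi> = positive_jacobianD[OF this]
  obtain N where N: "{x \<in> space M. \<not> P x} \<subseteq> N" "N \<in> null_sets M"
    using P by (auto simp: eventually_ae_filter)
  define S where "S = N \<inter> dom f"
  have S: "S \<in> null_sets M" "S \<subseteq> dom f"
    unfolding S_def using N(2) nonsingular_embedding_dom[OF f] by (auto intro: null_set_Int2)
  then have S': "S \<in> sets M" by auto
  have "emeasure M (img f S) = (\<integral>\<^sup>+x\<in>S. \<Phi> x \<partial>M)"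
    using \<Phi>(4) S S' by simp
  also have "\<dots> = 0"
    using S(1) \<Phi>(1) by (simp add: nn_integral_null_set)
  finally have "img f S \<in> null_sets M"
    using \<Phi>(3)[OF S' S(2)] by auto
  then have "AE y in M. y \<notin> img f S"
    by (rule AE_not_in)
  then show ?thesis
  proof eventually_elim
    case (elim y)
    show ?case
    proof (intro allI impI)
      fix x assume x: "f x = Some y"
      then have "x \<notin> S"
        using elim by (force intro: image_eqI[of _ _ x])
      then show "P x"
        using x N(1) nonsingular_embedding_in_space[OF f x] by (auto simp: S_def)
    qed
  qed
qed

lemma nonsingular_embedding_restrict:
  assumes "A \<in> sets M"
  shows "nonsingular_embedding M (Some |` A)"
proof (rule nonsingular_embeddingI)
  have dom: "dom (Some |` A) = A" "ran (Some |` A) = A"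
    by (auto simp: restrict_map_def ran_def split: if_splits)
  have img: "img (Some |` A) E = E" if "E \<subseteq> A" for E
    using that by (force simp: restrict_map_def)
  have "{x \<in> A. the ((Some |` A) x) \<in> B} = A \<inter> B" for B
    by (auto simp: restrict_map_def)
  then show "measurable_partial_map M (Some |` A)"
    unfolding measurable_partial_map_iff dom
    using assms sets.sets_into_space[OF assms] by auto
  show "positive_jacobian M (Some |` A) (\<lambda>_. 1)"
    unfolding positive_jacobian_def dom by (simp add: img)
qed (auto simp: restrict_map_def split: if_splits)

text \<open>
  Change of variables: the image under \<open>g\<close> of the measure with density \<open>\<Phi>\<close> is \<open>\<mu>\<close> restricted to
  \<open>ran g\<close>. Extending \<open>g\<close> by the identity to \<open>g'\<close> turns it into a measurable self-map of the space, to
  which the transformation formula for image measures applies.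
\<close>

lemma nonsingular_embedding_nn_integral:
  assumes g: "nonsingular_embedding M g" and \<Phi>: "positive_jacobian M g \<Phi>" and h: "h \<in> borel_measurable M"
    and g'_def: "g' = (\<lambda>x. if x \<in> dom g then the (g x) else x)"
  shows "g' \<in> M \<rightarrow>\<^sub>M M"
    and "(\<integral>\<^sup>+y\<in>ran g. h y \<partial>M) = (\<integral>\<^sup>+x\<in>dom g. \<Phi> x * h (g' x) \<partial>M)"
proof -
  have dom[measurable]: "dom g \<in> sets M" and ran[measurable]: "ran g \<in> sets M"
    using g by (auto intro: nonsingular_embedding_dom nonsingular_embedding_ran)
  have space: "dom g \<subseteq> space M"
    using dom by (rule sets.sets_into_space)
  show meas[measurable]: "g' \<in> M \<rightarrow>\<^sub>M M"
  proof (rule measurableI)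
    show "g' x \<in> space M" if "x \<in> space M" for x
      using that nonsingular_embedding_in_space[OF g] by (force simp: g'_def)
    fix A assume A: "A \<in> sets M"
    have "g' -` A \<inter> space M = {x \<in> dom g. the (g x) \<in> A} \<union> (A - dom g)"
      using space sets.sets_into_space[OF A] by (auto simp: g'_def split: if_splits)
    then show "g' -` A \<inter> space M \<in> sets M"
      using nonsingular_embedding_vimage[OF g A] A dom by simp
  qed
  note positive_jacobianD(1)[OF \<Phi>, measurable] h[measurable]
  have "distr (density M (\<lambda>x. \<Phi> x * indicator (dom g) x)) M g' = density M (indicator (ran g))"
  proof (rule measure_eqI)
    fix A assume "A \<in> sets (distr (density M (\<lambda>x. \<Phi> x * indicator (dom g) x)) M g')"
    then have A[measurable]: "A \<in> sets M" by simp
    let ?E = "{x \<in> dom g. the (g x) \<in> A}"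
    have E: "?E \<in> sets M" "?E \<subseteq> dom g"
      using nonsingular_embedding_vimage[OF g A] by auto
    have "emeasure (distr (density M (\<lambda>x. \<Phi> x * indicator (dom g) x)) M g') A
        = (\<integral>\<^sup>+x\<in>g' -` A \<inter> space M. \<Phi> x * indicator (dom g) x \<partial>M)"
      by (simp add: emeasure_distr emeasure_density)
    also have "\<dots> = (\<integral>\<^sup>+x\<in>?E. \<Phi> x \<partial>M)"
      by (intro nn_integral_cong) (auto simp: g'_def split: split_indicator)
    also have "\<dots> = emeasure M (img g ?E)"
      using positive_jacobianD(4)[OF \<Phi> E] by simp
    also have "img g ?E = ran g \<inter> A"
      by (force simp: ran_eq_img_dom)
    also have "emeasure M (ran g \<inter> A) = emeasure (density M (indicator (ran g))) A"
      using A ran by (simp add: emeasure_density flip: indicator_inter_arith)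
    finally show "emeasure (distr (density M (\<lambda>x. \<Phi> x * indicator (dom g) x)) M g') A
      = emeasure (density M (indicator (ran g))) A" .
  qed simp
  then have "(\<integral>\<^sup>+y. h y \<partial>density M (indicator (ran g)))
      = (\<integral>\<^sup>+y. h y \<partial>distr (density M (\<lambda>x. \<Phi> x * indicator (dom g) x)) M g')"
    by simp
  then show "(\<integral>\<^sup>+y\<in>ran g. h y \<partial>M) = (\<integral>\<^sup>+x\<in>dom g. \<Phi> x * h (g' x) \<partial>M)"
    by (simp add: nn_integral_density nn_integral_distr ac_simps)
qed

text \<open>
  The chain rule: with derivatives \<open>\<Phi>\<close> of \<open>f\<close> and \<open>\<Psi>\<close> of \<open>g\<close>, the product \<open>\<Psi> \<cdot> (\<Phi> \<circ> g)\<close> is a derivative of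
  the composite. It is positive because the preimage under \<open>g\<close> of the null set where \<open>\<Phi>\<close> fails to
  be positive is null.
\<close>

lemma nonsingular_embedding_comp:
  assumes f: "nonsingular_embedding M f" and g: "nonsingular_embedding M g"
  shows "nonsingular_embedding M (f \<circ>\<^sub>m g)"
proof -
  obtain \<Phi> where "positive_jacobian M f \<Phi>"
    using f by (rule nonsingular_embeddingE)
  note \<Phi> = positive_jacobianD[OF this]
  obtain \<Psi> where jac: "positive_jacobian M g \<Psi>"
    using g by (rule nonsingular_embeddingE)
  note \<Psi> = positive_jacobianD[OF this]
  note \<Phi>(1)[measurable] \<Psi>(1)[measurable]
  define g' where "g' = (\<lambda>x. if x \<in> dom g then the (g x) else x)"
  note change = nonsingular_embedding_nn_integral[OF g jac _ g'_def]
  have g'[measurable]: "g' \<in> M \<rightarrow>\<^sub>M M"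
    using change(1)[OF \<Phi>(1)] .
  have dom: "dom (f \<circ>\<^sub>m g) = {x \<in> dom g. the (g x) \<in> dom f}"
    by (auto simp: map_comp_def split: option.splits)
  have sub: "dom (f \<circ>\<^sub>m g) \<subseteq> dom g"
    unfolding dom by blast
  have img: "img (f \<circ>\<^sub>m g) E = img f (img g E)" if "E \<subseteq> dom g" for E
    using that by (force simp: map_comp_def image_image intro!: image_cong)
  show ?thesis
  proof (rule nonsingular_embeddingI)
    have "{x \<in> dom (f \<circ>\<^sub>m g). the ((f \<circ>\<^sub>m g) x) \<in> A}
        = {x \<in> dom g. the (g x) \<in> {y \<in> dom f. the (f y) \<in> A}}" for A
      by (auto simp: map_comp_def split: option.splits)
    moreover have "ran (f \<circ>\<^sub>m g) \<subseteq> ran f"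
      by (auto simp: ran_def map_comp_def split: option.splits)
    moreover have "{x \<in> dom g. the (g x) \<in> B} \<in> sets M" if "B \<in> sets M" for B
      using g that by (rule nonsingular_embedding_vimage)
    ultimately show "measurable_partial_map M (f \<circ>\<^sub>m g)"
      unfolding measurable_partial_map_iff dom[symmetric]
      using nonsingular_embedding_vimage[OF f] nonsingular_embedding_dom[OF f]
        sets.sets_into_space[OF nonsingular_embedding_ran[OF f]]
      by (simp add: dom del: mem_Collect_eq)
    show "x = y" if "(f \<circ>\<^sub>m g) x = Some z" "(f \<circ>\<^sub>m g) y = Some z" for x y z
      using that nonsingular_embedding_inj[OF f] nonsingular_embedding_inj[OF g]
      by (auto simp: map_comp_Some_iff)
    show "positive_jacobian M (f \<circ>\<^sub>m g) (\<lambda>x. \<Psi> x * \<Phi> (g' x))"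
      unfolding positive_jacobian_def
    proof (intro conjI ballI impI)
      show "(\<lambda>x. \<Psi> x * \<Phi> (g' x)) \<in> borel_measurable M"
        by measurable
      show "AE x in M. x \<in> dom (f \<circ>\<^sub>m g) \<longrightarrow> \<Psi> x * \<Phi> (g' x) > 0"
        using \<Psi>(2) AE_pullback[OF g \<Phi>(2)]
      proof eventually_elim
        case (elim x)
        then show ?case
          by (auto simp: dom g'_def ennreal_zero_less_mult_iff)
      qed
      show "img (f \<circ>\<^sub>m g) E \<in> sets M"
        "emeasure M (img (f \<circ>\<^sub>m g) E) = (\<integral>\<^sup>+x\<in>E. \<Psi> x * \<Phi> (g' x) \<partial>M)"
        if E: "E \<in> sets M" "E \<subseteq> dom (f \<circ>\<^sub>m g)" for E
      proof -
        have Eg: "E \<subseteq> dom g" and gE: "img g E \<in> sets M" "img g E \<subseteq> dom f"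
          using E sub \<Psi>(3)[OF E(1)] by (auto simp: dom)
        show "img (f \<circ>\<^sub>m g) E \<in> sets M"
          unfolding img[OF Eg] using gE by (rule \<Phi>(3))
        have "emeasure M (img (f \<circ>\<^sub>m g) E) = (\<integral>\<^sup>+y\<in>img g E. \<Phi> y \<partial>M)"
          unfolding img[OF Eg] using gE by (rule \<Phi>(4))
        also have "\<dots> = (\<integral>\<^sup>+y\<in>ran g. \<Phi> y * indicator (img g E) y \<partial>M)"
          using Eg by (intro nn_integral_cong) (auto simp: ran_eq_img_dom split: split_indicator)
        also have "\<dots> = (\<integral>\<^sup>+x\<in>dom g. \<Psi> x * (\<Phi> (g' x) * indicator (img g E) (g' x)) \<partial>M)"
          by (rule change(2)) (intro borel_measurable_times_ennreal borel_measurable_indicator \<Phi>(1) gE(1))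
        also have "\<dots> = (\<integral>\<^sup>+x\<in>E. \<Psi> x * \<Phi> (g' x) \<partial>M)"
        proof (rule nn_integral_cong)
          fix x
          \<comment> \<open>Injectivity is what makes \<open>g x \<in> g(E)\<close> equivalent to \<open>x \<in> E\<close>.\<close>
          have "g' x \<in> img g E \<longleftrightarrow> x \<in> E" if x: "x \<in> dom g"
          proof
            assume "g' x \<in> img g E"
            moreover have "g' x = the (g x)"
              using x by (simp only: g'_def if_True)
            ultimately obtain y where y: "y \<in> E" "the (g x) = the (g y)"
              by auto
            obtain z where "g x = Some z"
              using x by blast
            moreover obtain w where "g y = Some w"
              using y(1) Eg by blast
            ultimately have "x = y"
              using y(2) nonsingular_embedding_inj[OF g] by simp
            with y show "x \<in> E" by simp
          qed (use x in \<open>simp add: g'_def\<close>)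
          with Eg show "\<Psi> x * (\<Phi> (g' x) * indicator (img g E) (g' x)) * indicator (dom g) x
            = \<Psi> x * \<Phi> (g' x) * indicator E x"
            by (auto split: split_indicator)
        qed
        finally show "emeasure M (img (f \<circ>\<^sub>m g) E) = (\<integral>\<^sup>+x\<in>E. \<Psi> x * \<Phi> (g' x) \<partial>M)" .
      qed
    qed
  qed
qed

lemma foldr_map_comp: "foldr (\<circ>\<^sub>m) fs g = foldr (\<circ>\<^sub>m) fs Some \<circ>\<^sub>m g"
  by (induction fs) (auto simp: map_comp_def fun_eq_iff split: option.splits)

lemma map_comp_Some [simp]: "f \<circ>\<^sub>m Some = f"
  by (auto simp: map_comp_def)

lemma ran_map_comp: "ran (f \<circ>\<^sub>m g) = {z. \<exists>y. y \<in> ran g \<and> f y = Some z}"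
  by (auto simp: ran_def map_comp_Some_iff)

lemma dom_map_comp: "dom (f \<circ>\<^sub>m g) = {x. \<exists>y. g x = Some y \<and> y \<in> dom f}"
  by (auto simp: dom_def map_comp_Some_iff)

lemma AE_ran_mono:
  assumes "nonsingular_embedding M f" "AE x in M. f x = g x"
  shows "AE y in M. y \<in> ran f \<longrightarrow> y \<in> ran g"
  using AE_pushforward[OF assms]
proof eventually_elim
  case (elim y)
  show ?case
  proof
    assume "y \<in> ran f"
    then obtain x where "f x = Some y"
      by (auto simp: ran_def)
    with elim have "g x = Some y"
      by metis
    then show "y \<in> ran g"
      by (rule ranI)
  qed
qed

lemma semibranching_iff_AE:
  assumes "finite I" and emb: "\<And>i. i \<in> I \<Longrightarrow> nonsingular_embedding M (\<sigma> i)"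
  shows "semibranching M I \<sigma> \<longleftrightarrow>
    (AE x in M. \<exists>i\<in>I. x \<in> ran (\<sigma> i)) \<and>
    (\<forall>i\<in>I. \<forall>j\<in>I. i \<noteq> j \<longrightarrow> (AE x in M. x \<notin> ran (\<sigma> i) \<or> x \<notin> ran (\<sigma> j)))"
proof -
  have ran: "ran (\<sigma> i) \<in> sets M" if "i \<in> I" for i
    using emb[OF that] by (rule nonsingular_embedding_ran)
  have "space M - (\<Union>i\<in>I. ran (\<sigma> i)) \<in> sets M"
    using assms(1) ran by (intro sets.compl_sets sets.finite_UN) auto
  then have "space M - (\<Union>i\<in>I. ran (\<sigma> i)) \<in> null_sets M
      \<longleftrightarrow> (AE x in M. x \<notin> space M - (\<Union>i\<in>I. ran (\<sigma> i)))"
    by (rule AE_iff_null_sets)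
  also have "\<dots> \<longleftrightarrow> (AE x in M. \<exists>i\<in>I. x \<in> ran (\<sigma> i))"
    by (intro AE_cong) auto
  finally have cover: "space M - (\<Union>i\<in>I. ran (\<sigma> i)) \<in> null_sets M
      \<longleftrightarrow> (AE x in M. \<exists>i\<in>I. x \<in> ran (\<sigma> i))" .
  have disj: "ran (\<sigma> i) \<inter> ran (\<sigma> j) \<in> null_sets M
      \<longleftrightarrow> (AE x in M. x \<notin> ran (\<sigma> i) \<or> x \<notin> ran (\<sigma> j))" if "i \<in> I" "j \<in> I" for i j
    using ran[OF that(1)] ran[OF that(2)] by (subst AE_iff_null_sets) auto
  have "\<forall>i\<in>I. measurable_partial_map M (\<sigma> i)" "\<forall>i\<in>I. positive_RN_deriv M (\<sigma> i)"
    using emb by (simp_all add: nonsingular_embedding_def)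
  then show ?thesis
    unfolding semibranching_def cover using assms(1) disj by blast
qed

text \<open>
  The coding map is a left inverse of \<open>\<sigma>\<^sub>i\<close>, which makes \<open>\<sigma>\<^sub>i\<close> injective.
\<close>

lemma nonsingular_embedding_if_coding:
  assumes "semibranching M I \<sigma>" "coding_map M I \<sigma> c" "i \<in> I"
  shows "nonsingular_embedding M (\<sigma> i)"
proof -
  have "x = y" if "\<sigma> i x = Some z" "\<sigma> i y = Some z" for x y z
  proof -
    have "c (the (\<sigma> i x)) = x" "c (the (\<sigma> i y)) = y"
      using assms(2,3) that unfolding coding_map_def by blast+
    with that show ?thesis by simp
  qed
  moreover have "measurable_partial_map M (\<sigma> i)" "positive_RN_deriv M (\<sigma> i)"
    using assms(1,3) by (simp_all add: semibranching_def)
  ultimately show ?thesis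
    unfolding nonsingular_embedding_def by simp
qed


section \<open>Maps along edge sequences\<close>

locale edge_maps = higher_rank_graph \<Lambda>
  for \<Lambda> :: "('p, 'k::finite) kgraph" +
  fixes M :: "'a measure" and \<tau> :: "'p \<Rightarrow> 'a \<rightharpoonup> 'a" and \<phi> :: "'p \<Rightarrow> 'p list"
  assumes finite_paths: "finite (paths_of_degree \<Lambda> m)"
    and edge_embedding: "e \<in> edges \<Lambda> \<Longrightarrow> nonsingular_embedding M (\<tau> e)"
    and edge_cover: "AE x in M. \<exists>e\<in>paths_of_degree \<Lambda> (axis i 1). x \<in> ran (\<tau> e)"
    and edge_disjoint: "e \<in> paths_of_degree \<Lambda> (axis i 1) \<Longrightarrow>
      f \<in> paths_of_degree \<Lambda> (axis i 1) \<Longrightarrow> e \<noteq> f \<Longrightarrow> AE x in M. x \<notin> ran (\<tau> e) \<or> x \<notin> ran (\<tau> f)"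
    and edge_sequence_chosen: "h \<in> paths \<Lambda> \<Longrightarrow> deg \<Lambda> h \<noteq> 0 \<Longrightarrow> edge_sequence \<Lambda> (\<phi> h) h"
begin

abbreviation D :: "'p \<Rightarrow> 'a set" where
  "D \<equiv> vertex_domain \<Lambda> \<tau>"

abbreviation T :: "'p \<Rightarrow> 'a \<rightharpoonup> 'a" where
  "T \<equiv> path_maps \<Lambda> \<phi> \<tau>"

definition word :: "'p list \<Rightarrow> 'a \<rightharpoonup> 'a" where
  "word es = foldr (\<circ>\<^sub>m) (map \<tau> es) Some"

lemma word_Nil [simp]: "word [] = Some"
  by (simp add: word_def)

lemma word_Cons [simp]: "word (e # es) = \<tau> e \<circ>\<^sub>m word es"
  by (simp add: word_def)

lemma word_append: "word (es @ fs) = word es \<circ>\<^sub>m word fs"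
  unfolding word_def map_append foldr_append by (rule foldr_map_comp)

lemma path_map_eq_word: "deg \<Lambda> h \<noteq> 0 \<Longrightarrow> T h = word (\<phi> h)"
  by (simp add: path_maps_def word_def)

lemma path_map_vertex: "deg \<Lambda> v = 0 \<Longrightarrow> T v = Some |` D v"
  by (simp add: path_maps_def)

lemma edge_deg_nonzero: "e \<in> edges \<Lambda> \<Longrightarrow> deg \<Lambda> e \<noteq> 0"
  by (auto simp: edges_iff axis_eq_0_iff)

lemma path_map_edge: "e \<in> edges \<Lambda> \<Longrightarrow> T e = \<tau> e"
  using edge_sequence_edge[OF edge_sequence_chosen] edge_deg_nonzero
  by (simp add: path_map_eq_word)

lemma finite_edges: "finite (edges \<Lambda>)"
  by (simp add: edges_def finite_paths)

lemma vertex_domain_sets: "D v \<in> sets M"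
  unfolding vertex_domain_def
  by (intro sets.finite_UN) (auto simp: finite_edges intro: nonsingular_embedding_dom edge_embedding)

lemma dom_path_map_vertex: "deg \<Lambda> v = 0 \<Longrightarrow> dom (T v) = D v"
  and ran_path_map_vertex: "deg \<Lambda> v = 0 \<Longrightarrow> ran (T v) = D v"
  by (auto simp: path_map_vertex ran_def restrict_map_def split: if_splits)

text \<open>
  Composing with a vertex map on the left only cuts the domain down to the preimage of \<open>D\<^sub>v\<close>.
\<close>

lemma path_map_comp_vertex_left:
  assumes "deg \<Lambda> v = 0" "AE x in M. x \<in> ran f \<longrightarrow> x \<in> D v" "nonsingular_embedding M f"
  shows "AE x in M. (T v \<circ>\<^sub>m f) x = f x"
  using AE_pullback[OF assms(3,2)]
proof eventually_elim
  case (elim x)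
  then show ?case
    using assms(1) by (cases "f x") (auto simp: path_map_vertex ran_def)
qed

lemma edge_sequence_embedding:
  "edge_sequence \<Lambda> es h \<Longrightarrow> nonsingular_embedding M (word es)"
  by (induction rule: edge_sequence.induct)
     (simp_all add: edge_embedding nonsingular_embedding_comp)

lemma path_embedding: "h \<in> paths \<Lambda> \<Longrightarrow> nonsingular_embedding M (T h)"
  by (cases "deg \<Lambda> h = 0")
     (auto simp: path_map_vertex path_map_eq_word nonsingular_embedding_restrict vertex_domain_sets
       intro: edge_sequence_embedding edge_sequence_chosen)

end


section \<open>Paths under the compatibility conditions\<close>

locale compatible_edge_maps = edge_maps \<Lambda> M \<tau> \<phi>
  for \<Lambda> :: "('p, 'k::finite) kgraph" and M :: "'a measure"
    and \<tau> :: "'p \<Rightarrow> 'a \<rightharpoonup> 'a" and \<phi> :: "'p \<Rightarrow> 'p list" +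
  assumes dom_eq: "e \<in> edges \<Lambda> \<Longrightarrow> f \<in> edges \<Lambda> \<Longrightarrow> src \<Lambda> e = src \<Lambda> f \<Longrightarrow>
      AE x in M. x \<in> dom (\<tau> e) \<longleftrightarrow> x \<in> dom (\<tau> f)"
    and dom_positive: "v \<in> vertices \<Lambda> \<Longrightarrow> emeasure M (vertex_domain \<Lambda> \<tau> v) > 0"
    and dom_disjoint: "v \<in> vertices \<Lambda> \<Longrightarrow> w \<in> vertices \<Lambda> \<Longrightarrow> v \<noteq> w \<Longrightarrow>
      AE x in M. x \<notin> vertex_domain \<Lambda> \<tau> v \<or> x \<notin> vertex_domain \<Lambda> \<tau> w"
    and square: "l \<in> paths_of_degree \<Lambda> (axis i 1) \<Longrightarrow> b \<in> paths_of_degree \<Lambda> (axis i 1) \<Longrightarrow>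
      n \<in> paths_of_degree \<Lambda> (axis j 1) \<Longrightarrow> a \<in> paths_of_degree \<Lambda> (axis j 1) \<Longrightarrow>
      src \<Lambda> l = rng \<Lambda> a \<Longrightarrow> src \<Lambda> n = rng \<Lambda> b \<Longrightarrow> pcomp \<Lambda> l a = pcomp \<Lambda> n b \<Longrightarrow>
      (AE x in M. x \<in> ran (\<tau> a) \<longrightarrow> x \<in> dom (\<tau> l)) \<and>
      (AE x in M. (\<tau> l \<circ>\<^sub>m \<tau> a) x = (\<tau> n \<circ>\<^sub>m \<tau> b) x)"
begin

text \<open>
  Positive measure excludes the empty union: every vertex is the source of some edge. This supplies
  the edge that can be put in front of a given edge in the proof of \<open>edge_ran\<close>.
\<close>

lemma vertex_receives_edge:
  assumes "v \<in> paths \<Lambda>" "deg \<Lambda> v = 0"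
  obtains e where "e \<in> edges \<Lambda>" "src \<Lambda> e = v"
proof -
  have "D v \<noteq> {}"
    using dom_positive[of v] assms by (auto simp: paths_of_degree_def)
  then show thesis
    using that by (auto simp: vertex_domain_def)
qed

lemma edge_dom:
  assumes e: "e \<in> edges \<Lambda>"
  shows "AE x in M. x \<in> dom (\<tau> e) \<longleftrightarrow> x \<in> D (src \<Lambda> e)"
proof -
  let ?S = "{l \<in> edges \<Lambda>. src \<Lambda> l = src \<Lambda> e}"
  have "AE x in M. \<forall>l\<in>?S. x \<in> dom (\<tau> e) \<longleftrightarrow> x \<in> dom (\<tau> l)"
    using finite_edges e by (subst AE_finite_all) (auto intro: dom_eq)
  then show ?thesis
  proof eventually_elim
    case (elim x)
    have "e \<in> ?S"
      using e by simp
    with elim show ?case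
      unfolding vertex_domain_def by blast
  qed
qed

text \<open>
  Put any edge \<open>l\<close> in front of \<open>e\<close>; the path \<open>le\<close> of length two also factors with the degrees
  interchanged, and the commuting square gives \<open>R\<^sub>e \<subseteq> D\<^sub>l\<close>.
\<close>

lemma edge_ran:
  assumes e: "e \<in> edges \<Lambda>"
  shows "AE x in M. x \<in> ran (\<tau> e) \<longrightarrow> x \<in> D (rng \<Lambda> e)"
proof -
  obtain l where l: "l \<in> edges \<Lambda>" "src \<Lambda> l = rng \<Lambda> e"
    using vertex_receives_edge[of "rng \<Lambda> e"] e by auto
  obtain i j where ij: "deg \<Lambda> l = axis i 1" "deg \<Lambda> e = axis j 1"
    using l e by (auto simp: edges_iff)
  have "deg \<Lambda> (pcomp \<Lambda> l e) = axis j 1 + axis i 1"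
    using l e ij by (simp add: add.commute)
  then obtain n b where nb: "n \<in> paths \<Lambda>" "b \<in> paths \<Lambda>" "src \<Lambda> n = rng \<Lambda> b"
    "pcomp \<Lambda> l e = pcomp \<Lambda> n b" "deg \<Lambda> n = axis j 1" "deg \<Lambda> b = axis i 1"
    using factorization[of "pcomp \<Lambda> l e"] l e by (metis edge_path pcomp_path)
  have "AE x in M. x \<in> ran (\<tau> e) \<longrightarrow> x \<in> dom (\<tau> l)"
    using square[of l i b n j e] nb ij l e by (simp add: paths_of_degree_def)
  then show ?thesis
    using edge_dom[OF l(1)] unfolding l(2) by eventually_elim blast
qed

lemma edge_sequence_ran:
  assumes "edge_sequence \<Lambda> es h"
  shows "AE x in M. x \<in> ran (word es) \<longrightarrow> x \<in> D (rng \<Lambda> h)"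
  using assms
proof cases
  case single
  then show ?thesis
    using edge_ran by simp
next
  case (cons e es' h')
  then have "rng \<Lambda> h = rng \<Lambda> e"
    using edge_sequence_path by auto
  moreover have "ran (word es) \<subseteq> ran (\<tau> e)"
    unfolding cons by (auto simp: ran_map_comp intro: ranI)
  ultimately show ?thesis
    using edge_ran[OF cons(3)] by (auto elim!: AE_mp)
qed

lemma edge_sequence_dom:
  assumes "edge_sequence \<Lambda> es h"
  shows "AE x in M. x \<in> dom (word es) \<longleftrightarrow> x \<in> D (src \<Lambda> h)"
  using assms
proof (induction rule: edge_sequence.induct)
  case (single e)
  then show ?case
    using edge_dom by simp
next
  case (cons e es h)
  have "AE x in M. \<forall>y. word es x = Some y \<longrightarrow>
      (y \<in> ran (word es) \<longrightarrow> y \<in> D (rng \<Lambda> h)) \<and> (y \<in> dom (\<tau> e) \<longleftrightarrow> y \<in> D (rng \<Lambda> h))"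
    using edge_sequence_ran[OF cons(2)] edge_dom[OF cons(1)] cons(3)
    by (intro AE_pullback edge_sequence_embedding[OF cons(2)]) auto
  then have "AE x in M. x \<in> dom (word (e # es)) \<longleftrightarrow> x \<in> D (src \<Lambda> h)"
    using cons.IH by eventually_elim (auto simp: dom_map_comp intro: ranI)
  moreover have "src \<Lambda> (pcomp \<Lambda> e h) = src \<Lambda> h"
    using cons edge_sequence_path by auto
  ultimately show ?case
    by (simp only:)
qed

lemma path_dom:
  assumes "h \<in> paths \<Lambda>"
  shows "AE x in M. x \<in> dom (T h) \<longleftrightarrow> x \<in> D (src \<Lambda> h)"
  using assms edge_sequence_dom[OF edge_sequence_chosen[OF assms]]
  by (cases "deg \<Lambda> h = 0") (simp_all add: dom_path_map_vertex src_vertex path_map_eq_word)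

lemma path_ran:
  assumes "h \<in> paths \<Lambda>"
  shows "AE x in M. x \<in> ran (T h) \<longrightarrow> x \<in> D (rng \<Lambda> h)"
  using assms edge_sequence_ran[OF edge_sequence_chosen[OF assms]]
  by (cases "deg \<Lambda> h = 0") (simp_all add: ran_path_map_vertex rng_vertex path_map_eq_word)

text \<open>
  The empty word acts as the identity of the whole type, which may be larger than the space, so this
  is not an instance of \<open>AE_pullback\<close>.
\<close>

lemma AE_word_pullback:
  assumes "set es \<subseteq> edges \<Lambda>" "AE y in M. P y"
  shows "AE x in M. \<forall>y. word es x = Some y \<longrightarrow> P y"
  using assms
proof (induction es arbitrary: P)
  case (Cons e es)
  have "AE y in M. \<forall>z. \<tau> e y = Some z \<longrightarrow> P z"
    using Cons.prems by (intro AE_pullback edge_embedding) auto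
  then have "AE x in M. \<forall>y. word es x = Some y \<longrightarrow> (\<forall>z. \<tau> e y = Some z \<longrightarrow> P z)"
    using Cons.prems(1) by (intro Cons.IH) auto
  then show ?case
    by (auto simp: map_comp_Some_iff elim!: AE_mp)
qed simp

text \<open>
  If the two sequences start with edges \<open>e\<close> and \<open>f\<close> of the same degree, unique factorization makes these
  edges equal and the remaining sequences represent the same path. Otherwise \<open>h = e a q = f b q\<close> with
  \<open>e a = f b\<close> a commuting square; the induction hypothesis replaces the two tails by \<open>a q\<close> and \<open>b q\<close>, with
  one and the same sequence of edges for \<open>q\<close>.
\<close>

lemma word_unique:
  assumes "edge_sequence \<Lambda> es h" "edge_sequence \<Lambda> fs h"
  shows "AE x in M. word es x = word fs x"
  using assms
proof (induction "length es" arbitrary: es fs h rule: less_induct)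
  case less
  have len: "length es = length fs"
    using less.prems by (simp add: edge_sequence_length)
  from less.prems(1) show ?case
  proof cases
    case single
    with less.prems(2) have "fs = [h]"
      by (auto intro: edge_sequence_edge)
    with single show ?thesis by simp
  next
    case es: (cons e es' h')
    have "\<nexists>x. fs = [x]"
      using len es edge_sequence_nonempty by auto
    with less.prems(2) obtain f fs' g' where
      fs: "fs = f # fs'" "h = pcomp \<Lambda> f g'" "f \<in> edges \<Lambda>" "edge_sequence \<Lambda> fs' g'"
        "src \<Lambda> f = rng \<Lambda> g'"
      by (cases rule: edge_sequence.cases) auto
    have paths: "h' \<in> paths \<Lambda>" "g' \<in> paths \<Lambda>" "e \<in> paths \<Lambda>" "f \<in> paths \<Lambda>"
      using es fs by (auto intro: edge_sequence_path)
    obtain i j where ij: "deg \<Lambda> e = axis i 1" "deg \<Lambda> f = axis j 1"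
      using es fs by (auto simp: edges_iff)
    have deg: "axis i 1 + deg \<Lambda> h' = axis j 1 + deg \<Lambda> g'"
      using deg_pcomp[OF paths(3,1) es(5)] deg_pcomp[OF paths(4,2) fs(5)] es(2) fs(2) ij by simp
    show ?thesis
    proof (cases "i = j")
      case True
      then have "e = f \<and> h' = g'"
        by (intro factorization_unique) (use es fs paths ij in auto)
      then have "AE x in M. word es' x = word fs' x"
        using es fs by (intro less.hyps) auto
      then show ?thesis
        unfolding es fs using \<open>e = f \<and> h' = g'\<close> by (auto simp: map_comp_def elim!: AE_mp)
    next
      case False
      have "deg \<Lambda> h' $ j \<noteq> 0"
        using arg_cong[OF deg, of "\<lambda>m. m $ j"] False by (simp add: axis_def)
      then obtain n where n: "deg \<Lambda> h' = axis j 1 + n"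
        by (rule degree_split)
      obtain a q where aq: "a \<in> paths \<Lambda>" "q \<in> paths \<Lambda>" "src \<Lambda> a = rng \<Lambda> q" "h' = pcomp \<Lambda> a q"
        "deg \<Lambda> a = axis j 1" "deg \<Lambda> q = n"
        using factorization[OF paths(1) n] .
      have ea: "src \<Lambda> e = rng \<Lambda> a" "pcomp \<Lambda> e a \<in> paths \<Lambda>"
        "deg \<Lambda> (pcomp \<Lambda> e a) = axis j 1 + axis i 1" "src \<Lambda> (pcomp \<Lambda> e a) = src \<Lambda> a"
        using es aq paths ij by (simp_all add: add.commute)
      obtain f' b where fb: "f' \<in> paths \<Lambda>" "b \<in> paths \<Lambda>" "src \<Lambda> f' = rng \<Lambda> b"
        "pcomp \<Lambda> e a = pcomp \<Lambda> f' b" "deg \<Lambda> f' = axis j 1" "deg \<Lambda> b = axis i 1"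
        using factorization[OF ea(2,3)] .
      have bq: "src \<Lambda> b = rng \<Lambda> q"
        using src_pcomp[OF fb(1-3)] fb(4) ea(4) aq(3) by simp
      have "pcomp \<Lambda> f g' = pcomp \<Lambda> (pcomp \<Lambda> e a) q"
        using es(2) fs(2) aq(4) pcomp_assoc[OF paths(3) aq(1,2) ea(1) aq(3)] by simp
      also have "\<dots> = pcomp \<Lambda> f' (pcomp \<Lambda> b q)"
        using fb(4) pcomp_assoc[OF fb(1,2) aq(2) fb(3) bq] by simp
      finally have "f = f' \<and> g' = pcomp \<Lambda> b q"
        using fb(1-3,5) aq(2) bq paths(2,4) fs(5) ij by (intro factorization_unique) auto
      then have f': "f' = f" and g': "g' = pcomp \<Lambda> b q"
        by auto
      have edges: "a \<in> edges \<Lambda>" "b \<in> edges \<Lambda>"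
        using aq fb by (auto simp: edges_iff)
      \<comment> \<open>If \<open>q\<close> is a vertex it has no edge sequence; the empty word takes its place.\<close>
      define qs where "qs = (if deg \<Lambda> q = 0 then [] else \<phi> q)"
      have qs: "set qs \<subseteq> edges \<Lambda>"
        using edge_sequence_edges[OF edge_sequence_chosen[OF aq(2)]] by (simp add: qs_def)
      have ext: "edge_sequence \<Lambda> (x # qs) (pcomp \<Lambda> x q)"
        if "x \<in> edges \<Lambda>" "src \<Lambda> x = rng \<Lambda> q" for x
      proof (cases "deg \<Lambda> q = 0")
        case True
        then have "pcomp \<Lambda> x q = x"
          using that aq(2) pcomp_src[of x] by (simp add: rng_vertex)
        with True that show ?thesis
          by (simp add: qs_def edge_sequence.single)
      next
        case False
        with that aq(2) show ?thesis
          by (simp add: qs_def edge_sequence.cons edge_sequence_chosen)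
      qed
      have es': "AE x in M. word es' x = word (a # qs) x"
        using es ext[OF edges(1) aq(3)] aq(4) by (intro less.hyps) auto
      have fs': "AE x in M. word fs' x = word (b # qs) x"
        using fs len ext[OF edges(2) bq] g' by (intro less.hyps) auto
      have "AE y in M. (\<tau> e \<circ>\<^sub>m \<tau> a) y = (\<tau> f \<circ>\<^sub>m \<tau> b) y"
        using square[of e i b f j a] paths ij aq fb ea(1) f' by (simp add: paths_of_degree_def)
      then have "AE x in M. \<forall>y. word qs x = Some y \<longrightarrow> (\<tau> e \<circ>\<^sub>m \<tau> a) y = (\<tau> f \<circ>\<^sub>m \<tau> b) y"
        by (rule AE_word_pullback[OF qs])
      with es' fs' show ?thesis
      proof eventually_elim
        case (elim x)
        then show ?case
          unfolding es(1) fs(1) by (cases "word qs x") (simp_all add: map_comp_def)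
      qed
    qed
  qed
qed

text \<open>
  When both paths have nonzero degree, the concatenation of their chosen edge sequences is an edge
  sequence of the product, so this is an instance of \<open>word_unique\<close>. Vertices act as the identity, up to
  null sets, by \<open>path_ran\<close> and \<open>path_dom\<close>.
\<close>

lemma path_comp:
  assumes "l \<in> paths \<Lambda>" "n \<in> paths \<Lambda>" "src \<Lambda> l = rng \<Lambda> n"
  shows "AE x in M. (T l \<circ>\<^sub>m T n) x = T (pcomp \<Lambda> l n) x"
proof -
  consider "deg \<Lambda> l = 0" | "deg \<Lambda> n = 0" | "deg \<Lambda> l \<noteq> 0" "deg \<Lambda> n \<noteq> 0"
    by blast
  then show ?thesis
  proof cases
    case 1
    then have l: "l = rng \<Lambda> n"
      using assms by (simp add: src_vertex)
    then have "AE x in M. (T l \<circ>\<^sub>m T n) x = T n x"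
      using 1 assms path_ran[of n] path_embedding by (intro path_map_comp_vertex_left) auto
    then show ?thesis
      using l assms by simp
  next
    case 2
    then have n: "n = src \<Lambda> l"
      using assms by (simp add: rng_vertex)
    have "AE x in M. (T l \<circ>\<^sub>m T n) x = T l x"
      using path_dom[OF assms(1)]
    proof eventually_elim
      case (elim x)
      then show ?case
        using 2 n by (cases "x \<in> D n") (auto simp: path_map_vertex map_comp_def domIff)
    qed
    moreover have "pcomp \<Lambda> l n = l"
      unfolding n using assms(1) by (rule pcomp_src)
    ultimately show ?thesis
      by simp
  next
    case 3
    have "deg \<Lambda> (pcomp \<Lambda> l n) \<noteq> 0"
      using 3 assms by (auto simp: vec_eq_iff)
    moreover from this 3 assms
    have "AE x in M. word (\<phi> l @ \<phi> n) x = word (\<phi> (pcomp \<Lambda> l n)) x"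
      by (intro word_unique[of _ "pcomp \<Lambda> l n"] edge_sequence_append edge_sequence_chosen pcomp_path)
    ultimately show ?thesis
      using 3 by (simp add: path_map_eq_word word_append)
  qed
qed

text \<open>
  Degree 0 is covered because almost every point lies in the range of an edge, hence in some \<open>D\<^sub>v\<close>. For the
  sum of two degrees, let \<open>x = \<tau>\<^sub>l(y)\<close>; then \<open>y\<close> lies in \<open>R\<^sub>a\<close> for some \<open>a\<close>, and disjointness of the vertex
  domains forces \<open>a\<close> to start where \<open>l\<close> ends, so that \<open>x \<in> R\<^sub>l\<^sub>a\<close>.
\<close>

lemma path_cover: "AE x in M. \<exists>h\<in>paths_of_degree \<Lambda> m. x \<in> ran (T h)"
proof (induction m rule: degree_induct)
  case zero
  fix i :: 'k
  have "AE x in M. \<forall>e\<in>paths_of_degree \<Lambda> (axis i 1). x \<in> ran (\<tau> e) \<longrightarrow> x \<in> D (rng \<Lambda> e)"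
    using finite_paths by (subst AE_finite_all) (auto simp: paths_of_degree_def edges_iff intro!: edge_ran)
  with edge_cover[of i] show ?case
  proof eventually_elim
    case (elim x)
    then obtain e where e: "e \<in> paths \<Lambda>" "x \<in> D (rng \<Lambda> e)"
      by (auto simp: paths_of_degree_def)
    then show ?case
      by (intro bexI[of _ "rng \<Lambda> e"]) (simp_all add: ran_path_map_vertex paths_of_degree_def)
  qed
next
  case (axis i)
  have "e \<in> paths_of_degree \<Lambda> (axis i 1) \<Longrightarrow> T e = \<tau> e" for e
    by (auto simp: paths_of_degree_def edges_iff intro!: path_map_edge)
  with edge_cover[of i] show ?case
    by simp
next
  case (add m n)
  let ?comp = "\<lambda>l x. \<forall>a\<in>paths_of_degree \<Lambda> n. src \<Lambda> l = rng \<Lambda> a \<longrightarrow>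
    x \<in> ran (T l \<circ>\<^sub>m T a) \<longrightarrow> x \<in> ran (T (pcomp \<Lambda> l a))"
  have cover: "AE y in M. y \<in> dom (T l) \<longrightarrow>
      (\<exists>a\<in>paths_of_degree \<Lambda> n. src \<Lambda> l = rng \<Lambda> a \<and> y \<in> ran (T a))"
    if l: "l \<in> paths \<Lambda>" for l
  proof -
    have "AE y in M. \<forall>a\<in>paths_of_degree \<Lambda> n. y \<in> ran (T a) \<longrightarrow> y \<in> D (rng \<Lambda> a)"
      using finite_paths by (subst AE_finite_all) (auto simp: paths_of_degree_def intro: path_ran)
    moreover have "AE y in M. \<forall>v\<in>vertices \<Lambda>. v \<noteq> src \<Lambda> l \<longrightarrow> y \<notin> D v \<or> y \<notin> D (src \<Lambda> l)"
    proof (subst AE_finite_all[OF finite_paths], intro ballI)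
      fix v assume "v \<in> vertices \<Lambda>"
      then show "AE y in M. v \<noteq> src \<Lambda> l \<longrightarrow> y \<notin> D v \<or> y \<notin> D (src \<Lambda> l)"
        using l dom_disjoint[of v "src \<Lambda> l"] by (cases "v = src \<Lambda> l") (auto simp: paths_of_degree_def)
    qed
    ultimately show ?thesis
      using add(2) path_dom[OF l]
    proof eventually_elim
      case (elim y)
      show ?case
      proof
        assume "y \<in> dom (T l)"
        then have y: "y \<in> D (src \<Lambda> l)"
          using elim(4) by blast
        obtain a where a: "a \<in> paths_of_degree \<Lambda> n" "y \<in> ran (T a)"
          using elim(3) by blast
        then have "y \<in> D (rng \<Lambda> a)" "rng \<Lambda> a \<in> vertices \<Lambda>"
          using elim(1) by (auto simp: paths_of_degree_def)
        then have "src \<Lambda> l = rng \<Lambda> a"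
          using elim(2) y by metis
        with a show "\<exists>a\<in>paths_of_degree \<Lambda> n. src \<Lambda> l = rng \<Lambda> a \<and> y \<in> ran (T a)"
          by blast
      qed
    qed
  qed
  have "AE x in M. \<forall>l\<in>paths_of_degree \<Lambda> m. \<forall>y. T l y = Some x \<longrightarrow>
      (\<exists>a\<in>paths_of_degree \<Lambda> n. src \<Lambda> l = rng \<Lambda> a \<and> y \<in> ran (T a))"
  proof (subst AE_finite_all[OF finite_paths], intro ballI)
    fix l assume "l \<in> paths_of_degree \<Lambda> m"
    then have l: "l \<in> paths \<Lambda>"
      by (simp add: paths_of_degree_def)
    show "AE x in M. \<forall>y. T l y = Some x \<longrightarrow>
      (\<exists>a\<in>paths_of_degree \<Lambda> n. src \<Lambda> l = rng \<Lambda> a \<and> y \<in> ran (T a))"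
      using AE_pushforward[OF path_embedding[OF l] cover[OF l]] by eventually_elim blast
  qed
  moreover have "AE x in M. \<forall>l\<in>paths_of_degree \<Lambda> m. ?comp l x"
  proof (subst AE_finite_all[OF finite_paths], intro ballI, subst AE_finite_all[OF finite_paths], intro ballI)
    fix l a assume "l \<in> paths_of_degree \<Lambda> m" "a \<in> paths_of_degree \<Lambda> n"
    then have la: "l \<in> paths \<Lambda>" "a \<in> paths \<Lambda>"
      by (simp_all add: paths_of_degree_def)
    show "AE x in M. src \<Lambda> l = rng \<Lambda> a \<longrightarrow>
      x \<in> ran (T l \<circ>\<^sub>m T a) \<longrightarrow> x \<in> ran (T (pcomp \<Lambda> l a))"
    proof (cases "src \<Lambda> l = rng \<Lambda> a")
      case True
      with la show ?thesis
        by (simp, intro AE_ran_mono nonsingular_embedding_comp path_embedding path_comp)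
    qed simp
  qed
  ultimately show ?case
    using add(1)
  proof eventually_elim
    case (elim x)
    obtain l where l: "l \<in> paths_of_degree \<Lambda> m" "x \<in> ran (T l)"
      using elim(3) by blast
    then obtain y where y: "T l y = Some x"
      unfolding ran_def by blast
    obtain a where a: "a \<in> paths_of_degree \<Lambda> n" "src \<Lambda> l = rng \<Lambda> a" "y \<in> ran (T a)"
      using elim(1)[rule_format, OF l(1) y] by blast
    have "x \<in> ran (T l \<circ>\<^sub>m T a)"
      unfolding ran_map_comp using y a by blast
    then have "x \<in> ran (T (pcomp \<Lambda> l a))"
      using elim(2) l a by blast
    with l a show ?case
      by (intro bexI[of _ "pcomp \<Lambda> l a"]) (auto simp: paths_of_degree_def)
  qed
qed

text \<open>
  For products \<open>la\<close> and \<open>kb\<close> with \<open>l \<noteq> k\<close> the ranges are separated by those of \<open>l\<close> and \<open>k\<close>. If \<open>l = k\<close>,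
  injectivity of \<open>\<tau>\<^sub>l\<close> reduces the claim to \<open>a\<close> and \<open>b\<close>.
\<close>

lemma path_disjoint:
  assumes "h \<in> paths_of_degree \<Lambda> m" "g \<in> paths_of_degree \<Lambda> m" "h \<noteq> g"
  shows "AE x in M. x \<notin> ran (T h) \<or> x \<notin> ran (T g)"
  using assms
proof (induction m arbitrary: h g rule: degree_induct)
  case zero
  then have "deg \<Lambda> h = 0" "deg \<Lambda> g = 0"
    by (auto simp: paths_of_degree_def)
  then show ?case
    using dom_disjoint[OF zero] by (simp add: ran_path_map_vertex)
next
  case (axis i)
  then have "h \<in> edges \<Lambda>" "g \<in> edges \<Lambda>"
    by (auto simp: paths_of_degree_def edges_iff)
  then show ?case
    using edge_disjoint[OF axis] by (simp add: path_map_edge)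
next
  case (add m n)
  obtain l a where h: "l \<in> paths \<Lambda>" "a \<in> paths \<Lambda>" "src \<Lambda> l = rng \<Lambda> a" "h = pcomp \<Lambda> l a"
    "deg \<Lambda> l = m" "deg \<Lambda> a = n"
    using add.prems(1) factorization[of h m n] by (auto simp: paths_of_degree_def)
  obtain k b where g: "k \<in> paths \<Lambda>" "b \<in> paths \<Lambda>" "src \<Lambda> k = rng \<Lambda> b" "g = pcomp \<Lambda> k b"
    "deg \<Lambda> k = m" "deg \<Lambda> b = n"
    using add.prems(2) factorization[of g m n] by (auto simp: paths_of_degree_def)
  have ran: "AE x in M. x \<in> ran (T (pcomp \<Lambda> p q)) \<longrightarrow> x \<in> ran (T p \<circ>\<^sub>m T q)"
    if "p \<in> paths \<Lambda>" "q \<in> paths \<Lambda>" "src \<Lambda> p = rng \<Lambda> q" for p q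
  proof (rule AE_ran_mono)
    show "AE x in M. T (pcomp \<Lambda> p q) x = (T p \<circ>\<^sub>m T q) x"
      using path_comp[OF that] by eventually_elim simp
  qed (use that in \<open>simp add: path_embedding\<close>)
  show ?case
  proof (cases "l = k")
    case False
    then have "AE x in M. x \<notin> ran (T l) \<or> x \<notin> ran (T k)"
      using h g by (intro add.IH) (auto simp: paths_of_degree_def)
    then show ?thesis
      using ran[OF h(1-3)] ran[OF g(1-3)] unfolding h(4)[symmetric] g(4)[symmetric]
      by eventually_elim (auto simp: ran_map_comp intro: ranI)
  next
    case True
    then have "a \<noteq> b"
      using add.prems(3) h g by auto
    then have "AE y in M. y \<notin> ran (T a) \<or> y \<notin> ran (T b)"
      using h g by (intro add.IH) (auto simp: paths_of_degree_def)
    then have "AE x in M. \<forall>y. T l y = Some x \<longrightarrow> y \<notin> ran (T a) \<or> y \<notin> ran (T b)"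
      by (rule AE_pushforward[OF path_embedding[OF h(1)]])
    then show ?thesis
      using ran[OF h(1-3)] ran[OF g(1-3)] unfolding h(4)[symmetric] g(4)[symmetric]
    proof eventually_elim
      case (elim x)
      then show ?case
        using True nonsingular_embedding_inj[OF path_embedding[OF h(1)]]
        by (auto simp: ran_map_comp)
    qed
  qed
qed

end


section \<open>Coding maps of general degree\<close>

text \<open>
  The coding maps commute only on the space of the measure, so the identities for their products are
  relative to an invariant set \<open>S\<close>.
\<close>

locale commuting_maps =
  fixes c :: "'i \<Rightarrow> 'a \<Rightarrow> 'a" and S :: "'a set"
  assumes closed: "x \<in> S \<Longrightarrow> c i x \<in> S"
    and commute: "x \<in> S \<Longrightarrow> c i (c j x) = c j (c i x)"
begin

lemma funpow_closed: "x \<in> S \<Longrightarrow> (c i ^^ n) x \<in> S"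
  by (induction n) (auto intro: closed)

lemma funpow_commute1: "x \<in> S \<Longrightarrow> c i ((c j ^^ n) x) = (c j ^^ n) (c i x)"
  by (induction n) (simp_all add: commute[of _ i j] funpow_closed)

lemma funpow_commute: "x \<in> S \<Longrightarrow> (c i ^^ m) ((c j ^^ n) x) = (c j ^^ n) ((c i ^^ m) x)"
  by (induction m) (simp_all add: funpow_commute1 funpow_closed)

lemma prod_closed: "x \<in> S \<Longrightarrow> foldr (\<lambda>i. c i ^^ m i) ks x \<in> S"
  by (induction ks) (auto intro: funpow_closed)

lemma prod_commute:
  "x \<in> S \<Longrightarrow> (c i ^^ n) (foldr (\<lambda>i. c i ^^ m i) ks x) = foldr (\<lambda>i. c i ^^ m i) ks ((c i ^^ n) x)"
  by (induction ks) (simp_all add: funpow_commute[of _ n i] prod_closed)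

lemma prod_add:
  "x \<in> S \<Longrightarrow> foldr (\<lambda>i. c i ^^ (m i + n i)) ks x
    = foldr (\<lambda>i. c i ^^ m i) ks (foldr (\<lambda>i. c i ^^ n i) ks x)"
  by (induction ks) (simp_all add: funpow_add prod_commute prod_closed)

end

text \<open>
  The product of powers as an iterated application, a form in which the products can be compared point
  by point.
\<close>

lemma coding_power_apply:
  "coding_power c m x = foldr (\<lambda>i. c i ^^ (m $ i)) (sorted_list_of_set UNIV) x"
proof -
  have "foldr (\<circ>) (map f ks) id x = foldr f ks x" for f :: "'k \<Rightarrow> 'a \<Rightarrow> 'a" and ks and x
    by (induction ks) simp_all
  then show ?thesis
    by (simp only: coding_power_def)
qed

lemma coding_power_add:
  assumes "commuting_maps c S" "x \<in> S"
  shows "coding_power c (m + n) x = coding_power c m (coding_power c n x)"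
  using commuting_maps.prod_add[OF assms] by (simp add: coding_power_apply)

lemma coding_power_0: "coding_power c 0 = id"
proof
  have "foldr (\<lambda>i. c i ^^ 0) ks x = x" for ks x
    by (induction ks) simp_all
  then show "coding_power c 0 x = id x" for x
    by (simp add: coding_power_apply)
qed

lemma coding_power_axis: "coding_power c (axis i 1) = c i"
proof
  have "foldr (\<lambda>j. c j ^^ (axis i 1 $ j)) ks x = (if i \<in> set ks then c i x else x)"
    if "distinct ks" for ks x
    using that by (induction ks) (auto simp: axis_def)
  then show "coding_power c (axis i 1) x = c i x" for x
    by (simp add: coding_power_apply del: One_nat_def)
qed

lemma coding_power_measurable:
  assumes "\<And>i. c i \<in> M \<rightarrow>\<^sub>M M"
  shows "coding_power c m \<in> M \<rightarrow>\<^sub>M M"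
proof -
  have "(\<lambda>x. foldr (\<lambda>i. c i ^^ (m $ i)) ks x) \<in> M \<rightarrow>\<^sub>M M" for ks
  proof (induction ks)
    case (Cons i ks)
    from measurable_compose[OF this measurable_compose_n[OF assms]] show ?case
      by simp
  qed simp
  then show ?thesis
    by (simp add: coding_power_apply[abs_def] cong: measurable_cong)
qed


section \<open>The two implications\<close>

context edge_maps
begin

text \<open>
  The coding map of the first edge undoes the outermost map. It has to act first, that is, to stand on
  the right in the product, which is where the commutativity of the additive action \<open>C\<close> enters.
\<close>

lemma edge_sequence_coding:
  assumes C: "\<And>m n x. x \<in> space M \<Longrightarrow> C m (C n x) = C (m + n) x"
    and coding: "\<And>i. coding_map M (paths_of_degree \<Lambda> (axis i 1)) \<tau> (C (axis i 1))"
    and "edge_sequence \<Lambda> es h" "word es x = Some y"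
  shows "C (deg \<Lambda> h) y = x"
  using assms(3,4)
proof (induction arbitrary: y rule: edge_sequence.induct)
  case (single e)
  then show ?case
    using coding by (force simp: coding_map_def edges_iff paths_of_degree_def)
next
  case (cons e es h)
  have paths: "e \<in> paths \<Lambda>" "h \<in> paths \<Lambda>"
    using cons edge_sequence_path by auto
  obtain i where i: "deg \<Lambda> e = axis i 1"
    using cons by (auto simp: edges_iff)
  obtain z where z: "word es x = Some z" "\<tau> e z = Some y"
    using cons.prems by (auto simp: map_comp_Some_iff)
  have "y \<in> space M"
    using nonsingular_embedding_in_space[OF edge_embedding[OF cons(1)] z(2)] by simp
  then have "C (deg \<Lambda> (pcomp \<Lambda> e h)) y = C (deg \<Lambda> h) (C (axis i 1) y)"
    using paths cons(3) i by (simp add: C add.commute)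
  also have "C (axis i 1) y = z"
    using coding[of i] paths(1) i z(2) by (force simp: coding_map_def paths_of_degree_def)
  also have "C (deg \<Lambda> h) z = x"
    using z(1) by (rule cons.IH)
  finally show ?case .
qed

lemma path_coding:
  assumes C: "\<And>m n x. x \<in> space M \<Longrightarrow> C m (C n x) = C (m + n) x" and "C 0 = id"
    and coding: "\<And>i. coding_map M (paths_of_degree \<Lambda> (axis i 1)) \<tau> (C (axis i 1))"
    and h: "h \<in> paths \<Lambda>" "x \<in> dom (T h)"
  shows "C (deg \<Lambda> h) (the (T h x)) = x"
proof (cases "deg \<Lambda> h = 0")
  case True
  then show ?thesis
    using h \<open>C 0 = id\<close> by (auto simp: path_map_vertex restrict_map_def split: if_splits)
next
  case False
  obtain y where y: "T h x = Some y"
    using h(2) by blast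
  then have "C (deg \<Lambda> h) y = x"
    using False
    by (intro edge_sequence_coding[OF C coding edge_sequence_chosen[OF h(1)]])
       (simp_all add: path_map_eq_word)
  with y show ?thesis by simp
qed

text \<open>
  The axioms for general paths, specialised to vertices and edges. The last claim compares the cover in
  degree \<open>e\<^sub>i\<close> with the disjoint sets \<open>D\<^sub>w\<close>: almost every point of \<open>D\<^sub>v\<close> lies in some \<open>R\<^sub>g\<close>, which is
  contained in \<open>D\<close> of the range of \<open>g\<close>, so this range is \<open>v\<close>.
\<close>

lemma Lambda_semibranching_imp_compatible:
  assumes L: "Lambda_semibranching \<Lambda> M T C"
  shows dom_eq_if_Lambda_semibranching: "\<And>e f. e \<in> edges \<Lambda> \<Longrightarrow> f \<in> edges \<Lambda> \<Longrightarrow> src \<Lambda> e = src \<Lambda> f \<Longrightarrow>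
      AE x in M. x \<in> dom (\<tau> e) \<longleftrightarrow> x \<in> dom (\<tau> f)"
    and dom_positive_if_Lambda_semibranching: "\<And>v. v \<in> vertices \<Lambda> \<Longrightarrow> emeasure M (D v) > 0"
    and dom_disjoint_if_Lambda_semibranching: "\<And>v w. v \<in> vertices \<Lambda> \<Longrightarrow> w \<in> vertices \<Lambda> \<Longrightarrow> v \<noteq> w \<Longrightarrow>
      D v \<inter> D w \<in> null_sets M"
    and square_if_Lambda_semibranching: "\<And>l b n a. {l, b, n, a} \<subseteq> edges \<Lambda> \<Longrightarrow>
      src \<Lambda> l = rng \<Lambda> a \<Longrightarrow> src \<Lambda> n = rng \<Lambda> b \<Longrightarrow> pcomp \<Lambda> l a = pcomp \<Lambda> n b \<Longrightarrow>
      (AE x in M. x \<in> ran (\<tau> a) \<longrightarrow> x \<in> dom (\<tau> l)) \<and>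
      (AE x in M. (\<tau> l \<circ>\<^sub>m \<tau> a) x = (\<tau> n \<circ>\<^sub>m \<tau> b) x)"
    and vertex_cover_if_Lambda_semibranching: "\<And>v i. v \<in> vertices \<Lambda> \<Longrightarrow>
      D v - (\<Union>g\<in>{g \<in> paths_of_degree \<Lambda> (axis i 1). rng \<Lambda> g = v}. ran (\<tau> g)) \<in> null_sets M"
proof -
  have sb: "semibranching M (paths_of_degree \<Lambda> m) T" for m
    using L by (simp add: Lambda_semibranching_def)
  have comp: "AE x in M. x \<in> ran (T n) \<longrightarrow> x \<in> dom (T l)"
    "AE x in M. (T l \<circ>\<^sub>m T n) x = T (pcomp \<Lambda> l n) x"
    if "l \<in> paths \<Lambda>" "n \<in> paths \<Lambda>" "src \<Lambda> l = rng \<Lambda> n" for l n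
    using L that unfolding Lambda_semibranching_def by blast+
  show disj: "D v \<inter> D w \<in> null_sets M" if "v \<in> vertices \<Lambda>" "w \<in> vertices \<Lambda>" "v \<noteq> w" for v w
  proof -
    have "deg \<Lambda> v = 0" "deg \<Lambda> w = 0"
      using that by (simp_all add: paths_of_degree_def)
    moreover have "ran (T v) \<inter> ran (T w) \<in> null_sets M"
      using sb[of 0] that unfolding semibranching_def by blast
    ultimately show ?thesis
      by (simp add: ran_path_map_vertex)
  qed
  show "emeasure M (D v) > 0" if "v \<in> vertices \<Lambda>" for v
  proof -
    have "emeasure M (dom (T v)) > 0"
      using L that unfolding Lambda_semibranching_def by blast
    with that show ?thesis
      by (simp add: paths_of_degree_def dom_path_map_vertex)
  qed
  show "AE x in M. x \<in> dom (\<tau> e) \<longleftrightarrow> x \<in> dom (\<tau> f)"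
    if e: "e \<in> edges \<Lambda>" and f: "f \<in> edges \<Lambda>" and src: "src \<Lambda> e = src \<Lambda> f" for e f
  proof -
    \<comment> \<open>Composability of an edge with its source vertex says that \<open>D\<^sub>v\<close>, the union of all domains,
        lies in the domain of each single edge.\<close>
    have dom: "AE x in M. x \<in> D (src \<Lambda> g) \<longrightarrow> x \<in> dom (\<tau> g)" if "g \<in> edges \<Lambda>" for g
      using comp(1)[of g "src \<Lambda> g"] that by (simp add: ran_path_map_vertex path_map_edge)
    have sub: "dom (\<tau> g) \<subseteq> D (src \<Lambda> g)" if "g \<in> edges \<Lambda>" for g
      using that by (auto simp: vertex_domain_def)
    show ?thesis
      using dom[OF e] dom[OF f] by eventually_elim (use sub[OF e] sub[OF f] src in auto)
  qed
  show "(AE x in M. x \<in> ran (\<tau> a) \<longrightarrow> x \<in> dom (\<tau> l)) \<and>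
      (AE x in M. (\<tau> l \<circ>\<^sub>m \<tau> a) x = (\<tau> n \<circ>\<^sub>m \<tau> b) x)"
    if "{l, b, n, a} \<subseteq> edges \<Lambda>" "src \<Lambda> l = rng \<Lambda> a" "src \<Lambda> n = rng \<Lambda> b"
      "pcomp \<Lambda> l a = pcomp \<Lambda> n b" for l b n a
  proof
    have edges: "l \<in> edges \<Lambda>" "b \<in> edges \<Lambda>" "n \<in> edges \<Lambda>" "a \<in> edges \<Lambda>"
      using that(1) by auto
    show "AE x in M. x \<in> ran (\<tau> a) \<longrightarrow> x \<in> dom (\<tau> l)"
      using comp(1)[of l a] edges that(2) by (simp add: path_map_edge)
    have "AE x in M. (\<tau> l \<circ>\<^sub>m \<tau> a) x = T (pcomp \<Lambda> l a) x"
      "AE x in M. (\<tau> n \<circ>\<^sub>m \<tau> b) x = T (pcomp \<Lambda> n b) x"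
      using comp(2)[of l a] comp(2)[of n b] edges that(2,3) by (simp_all add: path_map_edge)
    then show "AE x in M. (\<tau> l \<circ>\<^sub>m \<tau> a) x = (\<tau> n \<circ>\<^sub>m \<tau> b) x"
      unfolding that(4) by eventually_elim simp
  qed
  show "D v - (\<Union>g\<in>{g \<in> paths_of_degree \<Lambda> (axis i 1). rng \<Lambda> g = v}. ran (\<tau> g)) \<in> null_sets M"
    (is "?N \<in> _") if v: "v \<in> vertices \<Lambda>" for v i
  proof -
    let ?E = "paths_of_degree \<Lambda> (axis i 1)"
    have edges: "g \<in> edges \<Lambda>" if "g \<in> ?E" for g
      using that by (auto simp: edges_iff paths_of_degree_def)
    have "AE x in M. \<forall>g\<in>?E. x \<in> ran (\<tau> g) \<longrightarrow> x \<in> D (rng \<Lambda> g)"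
    proof (subst AE_finite_all[OF finite_paths], intro ballI)
      fix g assume "g \<in> ?E"
      then show "AE x in M. x \<in> ran (\<tau> g) \<longrightarrow> x \<in> D (rng \<Lambda> g)"
        using comp(1)[of "rng \<Lambda> g" g] edges by (simp add: path_map_edge dom_path_map_vertex)
    qed
    moreover have "AE x in M. \<forall>w\<in>vertices \<Lambda>. v \<noteq> w \<longrightarrow> x \<notin> D v \<inter> D w"
    proof (subst AE_finite_all[OF finite_paths], intro ballI)
      fix w assume w: "w \<in> vertices \<Lambda>"
      show "AE x in M. v \<noteq> w \<longrightarrow> x \<notin> D v \<inter> D w"
        using AE_not_in[OF disj[OF v w]] by (cases "v = w") simp_all
    qed
    ultimately have "AE x in M. x \<notin> ?N"
      using edge_cover[of i]
    proof eventually_elim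
      case (elim x)
      obtain g where g: "g \<in> ?E" "x \<in> ran (\<tau> g)"
        using elim(3) by blast
      then have "x \<in> D (rng \<Lambda> g)" "rng \<Lambda> g \<in> vertices \<Lambda>"
        using elim(1) by (auto simp: paths_of_degree_def)
      then have "x \<notin> D v \<or> v = rng \<Lambda> g"
        using elim(2) by blast
      with g show ?case by blast
    qed
    moreover have "?N \<in> sets M"
      using finite_paths edges
      by (intro sets.Diff sets.finite_UN vertex_domain_sets)
         (auto intro: nonsingular_embedding_ran edge_embedding)
    ultimately show ?thesis
      by (simp add: AE_iff_null_sets)
  qed
qed

end

lemma (in compatible_edge_maps) Lambda_semibranching_path_maps:
  assumes C: "\<And>m n x. x \<in> space M \<Longrightarrow> C m (C n x) = C (m + n) x" and "C 0 = id"
    and measurable: "\<And>m. C m \<in> M \<rightarrow>\<^sub>M M"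
    and coding: "\<And>i. coding_map M (paths_of_degree \<Lambda> (axis i 1)) \<tau> (C (axis i 1))"
  shows "Lambda_semibranching \<Lambda> M T C"
  unfolding Lambda_semibranching_def
proof (intro conjI allI ballI impI)
  fix m
  have path: "h \<in> paths \<Lambda>" "deg \<Lambda> h = m" if "h \<in> paths_of_degree \<Lambda> m" for h
    using that by (auto simp: paths_of_degree_def)
  show "semibranching M (paths_of_degree \<Lambda> m) T"
    using path_cover path_disjoint
    by (subst semibranching_iff_AE) (auto intro: finite_paths path_embedding path)
  show "coding_map M (paths_of_degree \<Lambda> m) T (C m)"
    unfolding coding_map_def
  proof (intro conjI ballI)
    fix h x assume h: "h \<in> paths_of_degree \<Lambda> m" and x: "x \<in> dom (T h)"
    show "C m (the (T h x)) = x"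
      using path_coding[OF C \<open>C 0 = id\<close> coding path(1)[OF h] x] unfolding path(2)[OF h] .
  qed (rule measurable)
next
  fix v x assume v: "v \<in> vertices \<Lambda>"
  then have deg: "deg \<Lambda> v = 0"
    by (simp add: paths_of_degree_def)
  show "emeasure M (dom (T v)) > 0"
    using dom_positive[OF v] deg by (simp add: dom_path_map_vertex)
  show "T v x = Some x" if "x \<in> dom (T v)"
    using that deg by (simp add: dom_path_map_vertex) (simp add: path_map_vertex)
next
  fix l n assume ln: "l \<in> paths \<Lambda>" "n \<in> paths \<Lambda>" "src \<Lambda> l = rng \<Lambda> n"
  show "AE x in M. (T l \<circ>\<^sub>m T n) x = T (pcomp \<Lambda> l n) x"
    using ln by (rule path_comp)
  show "AE x in M. x \<in> ran (T n) \<longrightarrow> x \<in> dom (T l)"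
    using path_ran[OF ln(2)] path_dom[OF ln(1)] unfolding ln(3) by eventually_elim blast
qed (rule C)

theorem theorem3p1:
  fixes \<Lambda> :: "('p, 'k::{finite,linorder}) kgraph"
    and M :: "'a measure"
    and \<tau> :: "'p \<Rightarrow> 'a \<rightharpoonup> 'a"
    and c :: "'k \<Rightarrow> 'a \<Rightarrow> 'a"
    and \<phi> :: "'p \<Rightarrow> 'p list"
  assumes "finite_k_graph \<Lambda>"
    and "\<And>i. semibranching M (paths_of_degree \<Lambda> (axis i 1)) \<tau>"
    and "\<And>i. coding_map M (paths_of_degree \<Lambda> (axis i 1)) \<tau> (c i)"
    and "\<And>h. h \<in> paths \<Lambda> \<Longrightarrow> deg \<Lambda> h \<noteq> 0 \<Longrightarrow> edge_sequence \<Lambda> (\<phi> h) h"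
  shows
    "((\<forall>l\<in>edges \<Lambda>. \<forall>n\<in>edges \<Lambda>. src \<Lambda> l = src \<Lambda> n \<longrightarrow>
         (AE x in M. x \<in> dom (\<tau> l) \<longleftrightarrow> x \<in> dom (\<tau> n))) \<and>
      (\<forall>v\<in>vertices \<Lambda>. emeasure M (vertex_domain \<Lambda> \<tau> v) > 0) \<and>
      (\<forall>v\<in>vertices \<Lambda>. \<forall>w\<in>vertices \<Lambda>. v \<noteq> w \<longrightarrow>
         vertex_domain \<Lambda> \<tau> v \<inter> vertex_domain \<Lambda> \<tau> w \<in> null_sets M) \<and>
      (\<forall>i j. \<forall>l\<in>paths_of_degree \<Lambda> (axis i 1). \<forall>b\<in>paths_of_degree \<Lambda> (axis i 1).
         \<forall>n\<in>paths_of_degree \<Lambda> (axis j 1). \<forall>a\<in>paths_of_degree \<Lambda> (axis j 1).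
         src \<Lambda> l = rng \<Lambda> a \<and> src \<Lambda> n = rng \<Lambda> b \<and> pcomp \<Lambda> l a = pcomp \<Lambda> n b \<longrightarrow>
         (AE x in M. x \<in> ran (\<tau> a) \<longrightarrow> x \<in> dom (\<tau> l)) \<and>
         (AE x in M. x \<in> ran (\<tau> b) \<longrightarrow> x \<in> dom (\<tau> n)) \<and>
         (AE x in M. (\<tau> l \<circ>\<^sub>m \<tau> a) x = (\<tau> n \<circ>\<^sub>m \<tau> b) x)) \<and>
      (\<forall>i j. \<forall>x\<in>space M. c i (c j x) = c j (c i x)) \<and>
      (\<forall>v\<in>vertices \<Lambda>. \<forall>i.
         vertex_domain \<Lambda> \<tau> v -
           (\<Union>g\<in>{g \<in> paths_of_degree \<Lambda> (axis i 1). rng \<Lambda> g = v}. ran (\<tau> g)) \<in> null_sets M))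
     \<longleftrightarrow> Lambda_semibranching \<Lambda> M (path_maps \<Lambda> \<phi> \<tau>) (coding_power c)"
proof -
  have k_graph: "k_graph \<Lambda>" and finite: "finite (paths_of_degree \<Lambda> m)" for m
    using assms(1) by (simp_all add: finite_k_graph_def)
  have emb: "nonsingular_embedding M (\<tau> e)" if "e \<in> paths_of_degree \<Lambda> (axis i 1)" for e i
    using assms(2,3) that by (rule nonsingular_embedding_if_coding)
  have AE: "AE x in M. \<exists>e\<in>paths_of_degree \<Lambda> (axis i 1). x \<in> ran (\<tau> e)"
    "\<forall>e\<in>paths_of_degree \<Lambda> (axis i 1). \<forall>f\<in>paths_of_degree \<Lambda> (axis i 1). e \<noteq> f \<longrightarrow>
      (AE x in M. x \<notin> ran (\<tau> e) \<or> x \<notin> ran (\<tau> f))" for i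
    using assms(2)[of i] semibranching_iff_AE[of "paths_of_degree \<Lambda> (axis i 1)" M \<tau>] finite emb
    by blast+
  interpret edge_maps \<Lambda> M \<tau> \<phi>
  proof
    show "nonsingular_embedding M (\<tau> e)" if "e \<in> edges \<Lambda>" for e
      using that emb by (auto simp: edges_def)
    show "AE x in M. x \<notin> ran (\<tau> e) \<or> x \<notin> ran (\<tau> f)"
      if "e \<in> paths_of_degree \<Lambda> (axis i 1)" "f \<in> paths_of_degree \<Lambda> (axis i 1)" "e \<noteq> f" for e f i
      using AE(2)[of i] that by blast
  qed (fact k_graph finite AE(1) assms(4))+
  have edges: "e \<in> edges \<Lambda>" if "e \<in> paths_of_degree \<Lambda> (axis i 1)" for e i
    using that by (auto simp: edges_def)
  have null_iff: "D v \<inter> D w \<in> null_sets M \<longleftrightarrow> (AE x in M. x \<notin> D v \<or> x \<notin> D w)" for v w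
    by (subst AE_iff_null_sets) (simp_all add: vertex_domain_sets sets.Int)
  show ?thesis (is "(?i \<and> ?pos \<and> ?ii \<and> ?iii \<and> ?iv \<and> ?v) \<longleftrightarrow> ?L")
  proof
    assume A: "?i \<and> ?pos \<and> ?ii \<and> ?iii \<and> ?iv \<and> ?v"
    then have i: ?i and pos: ?pos and ii: ?ii and iii: ?iii and iv: ?iv
      by - (elim conjE, assumption)+
    interpret compatible_edge_maps \<Lambda> M \<tau> \<phi>
    proof
      fix e f assume "e \<in> edges \<Lambda>" "f \<in> edges \<Lambda>" "src \<Lambda> e = src \<Lambda> f"
      with i show "AE x in M. x \<in> dom (\<tau> e) \<longleftrightarrow> x \<in> dom (\<tau> f)"
        by blast
    next
      fix v assume "v \<in> vertices \<Lambda>"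
      with pos show "emeasure M (D v) > 0"
        by blast
    next
      fix v w assume "v \<in> vertices \<Lambda>" "w \<in> vertices \<Lambda>" "v \<noteq> w"
      with ii show "AE x in M. x \<notin> D v \<or> x \<notin> D w"
        unfolding null_iff by blast
    next
      fix i j l b n a
      assume "l \<in> paths_of_degree \<Lambda> (axis i 1)" "b \<in> paths_of_degree \<Lambda> (axis i 1)"
        "n \<in> paths_of_degree \<Lambda> (axis j 1)" "a \<in> paths_of_degree \<Lambda> (axis j 1)"
        "src \<Lambda> l = rng \<Lambda> a" "src \<Lambda> n = rng \<Lambda> b" "pcomp \<Lambda> l a = pcomp \<Lambda> n b"
      with iii show "(AE x in M. x \<in> ran (\<tau> a) \<longrightarrow> x \<in> dom (\<tau> l)) \<and>
        (AE x in M. (\<tau> l \<circ>\<^sub>m \<tau> a) x = (\<tau> n \<circ>\<^sub>m \<tau> b) x)"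
        by blast
    qed
    have meas: "c i \<in> M \<rightarrow>\<^sub>M M" for i
      using assms(3) by (simp add: coding_map_def)
    have c: "commuting_maps c (space M)"
      using iv measurable_space[OF meas] by unfold_locales blast+
    show ?L
    proof (rule Lambda_semibranching_path_maps)
      show "coding_map M (paths_of_degree \<Lambda> (axis i 1)) \<tau> (coding_power c (axis i 1))" for i
        unfolding coding_power_axis by (rule assms(3))
    qed (rule coding_power_add[OF c, symmetric] coding_power_0 coding_power_measurable meas, assumption?)+
  next
    assume L: ?L
    note compatible = Lambda_semibranching_imp_compatible[OF L]
    have "c i (c j x) = c j (c i x)" if "x \<in> space M" for i j x
    proof -
      have "coding_power c m (coding_power c n x) = coding_power c (m + n) x" for m n
        using L that by (simp add: Lambda_semibranching_def)
      from this[of "axis i 1" "axis j 1"] this[of "axis j 1" "axis i 1"] show ?thesis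
        unfolding coding_power_axis by (simp add: add.commute)
    qed
    moreover have "(AE x in M. x \<in> ran (\<tau> a) \<longrightarrow> x \<in> dom (\<tau> l)) \<and>
        (AE x in M. x \<in> ran (\<tau> b) \<longrightarrow> x \<in> dom (\<tau> n)) \<and>
        (AE x in M. (\<tau> l \<circ>\<^sub>m \<tau> a) x = (\<tau> n \<circ>\<^sub>m \<tau> b) x)"
      if "l \<in> paths_of_degree \<Lambda> (axis i 1)" "b \<in> paths_of_degree \<Lambda> (axis i 1)"
        "n \<in> paths_of_degree \<Lambda> (axis j 1)" "a \<in> paths_of_degree \<Lambda> (axis j 1)"
        "src \<Lambda> l = rng \<Lambda> a \<and> src \<Lambda> n = rng \<Lambda> b \<and> pcomp \<Lambda> l a = pcomp \<Lambda> n b" for i j l b n a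
    proof -
      have "{l, b, n, a} \<subseteq> edges \<Lambda>" "{n, a, l, b} \<subseteq> edges \<Lambda>"
        using that edges by auto
      from compatible(4)[OF this(1)] compatible(4)[OF this(2)] that(5) show ?thesis
        by simp
    qed
    ultimately have iii: ?iii and iv: ?iv
      by blast+
    have i: ?i and pos: ?pos and ii: ?ii and v: ?v
      using compatible(1-3,5) by blast+
    show "?i \<and> ?pos \<and> ?ii \<and> ?iii \<and> ?iv \<and> ?v"
      by (intro conjI i pos ii iii iv v)
  qed
qed

end
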